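(* Let $M$ be the field of meromorphic functions on $\mathbb C$ with $\phi(f)(z)=f(z+1)$, and let $\mathbf k:=M^\phi$ be the field of $1$-periodic meromorphic functions. Let $a\in\mathbb C(z)\setminus\{0\}$. Assume that there exists a non-zero $b\in\mathbf k\,M_{<1}$ such that $\phi(b)=ab$. Then (1) there also exists a non-zero $b'\in M_{<1}$ with $\phi(b')=ab'$, (2) $b\in\mathbf k(z)$.
   Context: $M_{<1}:=\{g\in M\mid T(r,g)=o(r),\ r\to+\infty\}$, where $T(r,g)=m(r,g)+N(r,g)$ is the Nevanlinna characteristic: $m(r,g)=\frac1{2\pi}\int_0^{2\pi}\log^+|g(re^{i\theta})|\,d\theta$ and $N(r,g)=\int_0^r\frac{n(t,g)-n(0,g)}{t}\,dt+n(0,g)\log r$, with $n(t,g)$ the number of poles of $g$ in $|z|\le t$ counted with multiplicity. $M_{<1}$ is a subfield of $M$, stable under $\phi$ and containing $\mathbb C(z)$. $\mathbf k\,M_{<1}$ denotes the compositum of the fields $\mathbf k$ and $M_{<1}$ inside $M$. *)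

theory Defs
  imports
    "HOL-Complex_Analysis.Complex_Analysis"
    "HOL-Algebra.Generated_Fields"
    "HOL-Library.Landau_Symbols"
begin

text \<open>
  A meromorphic function on the complex plane is represented by its unique nicely meromorphic
  representative: it is continuous wherever it has no pole, and takes the value 0 at its poles.
  Hence equality in the field of meromorphic functions is equality of HOL functions. The
  pointwise sum or product of two such representatives may take a wrong value at a removable
  singularity (for instance \<open>(1/z) * z\<close> at 0), which \<^const>\<open>remove_sings\<close> repairs.
\<close>

definition mero :: "(complex \<Rightarrow> complex) ring" where
  "mero = \<lparr> carrier = {f. f nicely_meromorphic_on UNIV},
            mult = (\<lambda>f g. remove_sings (\<lambda>z. f z * g z)),
            one = (\<lambda>_. 1),
            zero = (\<lambda>_. 0),
            add = (\<lambda>f g. remove_sings (\<lambda>z. f z + g z)) \<rparr>"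

definition shift :: "(complex \<Rightarrow> complex) \<Rightarrow> complex \<Rightarrow> complex" where
  "shift f = (\<lambda>z. f (z + 1))"

definition periodic_mero :: "(complex \<Rightarrow> complex) set" where
  "periodic_mero = {f \<in> carrier mero. shift f = f}"

definition rational_mero :: "(complex \<Rightarrow> complex) set" where
  "rational_mero = {remove_sings (\<lambda>z. poly p z / poly q z) | p q. q \<noteq> 0}"

definition log_plus :: "real \<Rightarrow> real" where
  "log_plus x = (if x \<le> 1 then 0 else ln x)"

definition nev_proximity :: "real \<Rightarrow> (complex \<Rightarrow> complex) \<Rightarrow> real" where
  "nev_proximity r g =
     1 / (2 * pi) * integral {0..2*pi} (\<lambda>\<theta>. log_plus (cmod (g (of_real r * exp (\<i> * of_real \<theta>)))))"

text \<open>The poles of a meromorphic function in a closed disc form a finite set, and the order of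
  a pole is the negated \<^const>\<open>zorder\<close>.\<close>

definition pole_count :: "real \<Rightarrow> (complex \<Rightarrow> complex) \<Rightarrow> nat" where
  "pole_count t g = (\<Sum>z\<in>{z. cmod z \<le> t \<and> is_pole g z}. nat (- zorder g z))"

definition nev_counting :: "real \<Rightarrow> (complex \<Rightarrow> complex) \<Rightarrow> real" where
  "nev_counting r g =
     integral {0..r} (\<lambda>t. (real (pole_count t g) - real (pole_count 0 g)) / t)
     + real (pole_count 0 g) * ln r"

definition nev_char :: "real \<Rightarrow> (complex \<Rightarrow> complex) \<Rightarrow> real" where
  "nev_char r g = nev_proximity r g + nev_counting r g"

definition mero_less_1 :: "(complex \<Rightarrow> complex) set" where
  "mero_less_1 = {g \<in> carrier mero. (\<lambda>r. nev_char r g) \<in> o[at_top](\<lambda>r. r)}"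

definition compositum :: "(complex \<Rightarrow> complex) set \<Rightarrow> (complex \<Rightarrow> complex) set \<Rightarrow> (complex \<Rightarrow> complex) set" where
  "compositum K L = generate_field mero (K \<union> L)"

definition adjoin_z :: "(complex \<Rightarrow> complex) set \<Rightarrow> (complex \<Rightarrow> complex) set" where
  "adjoin_z K = generate_field mero (insert (\<lambda>z. z) K)"

lemma nicely_mero_remove_sings:
  "f nicely_meromorphic_on UNIV \<Longrightarrow> remove_sings f = f"
proof
  fix z assume "f nicely_meromorphic_on UNIV"
  then have "(is_pole f z \<and> f z = 0) \<or> f \<midarrow>z\<rightarrow> f z"
    by (auto simp: nicely_meromorphic_on_def)
  then show "remove_sings f z = f z" by auto
qed

lemma eventually_remove_sings_eq_mero:
  "f meromorphic_on UNIV \<Longrightarrow> \<forall>\<^sub>F w in at z. remove_sings f w = f w"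
  by (rule eventually_remove_sings_eq_at)
    (meson UNIV_I meromorphic_at_iff meromorphic_on_meromorphic_at)

lemma remove_sings_eqI_at:
  assumes "\<And>z. \<forall>\<^sub>F w in at z. f w = g w"
  shows "remove_sings f = remove_sings g"
  using assms by (intro ext remove_sings_cong) auto

lemma nice_imp_mero: "f nicely_meromorphic_on A \<Longrightarrow> f meromorphic_on A"
  by (simp add: nicely_meromorphic_on_def)

lemma remove_sings_mult_left:
  assumes "f meromorphic_on UNIV"
  shows "remove_sings (\<lambda>z. remove_sings f z * g z) = remove_sings (\<lambda>z. f z * g z)"
  by (rule remove_sings_eqI_at) (rule eventually_mono[OF eventually_remove_sings_eq_mero[OF assms]], simp)

lemma remove_sings_mult_right:
  assumes "f meromorphic_on UNIV"
  shows "remove_sings (\<lambda>z. g z * remove_sings f z) = remove_sings (\<lambda>z. g z * f z)"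
  by (rule remove_sings_eqI_at) (rule eventually_mono[OF eventually_remove_sings_eq_mero[OF assms]], simp)

lemma remove_sings_add_left:
  assumes "f meromorphic_on UNIV"
  shows "remove_sings (\<lambda>z. remove_sings f z + g z) = remove_sings (\<lambda>z. f z + g z)"
  by (rule remove_sings_eqI_at) (rule eventually_mono[OF eventually_remove_sings_eq_mero[OF assms]], simp)

lemma remove_sings_add_right:
  assumes "f meromorphic_on UNIV"
  shows "remove_sings (\<lambda>z. g z + remove_sings f z) = remove_sings (\<lambda>z. g z + f z)"
  by (rule remove_sings_eqI_at) (rule eventually_mono[OF eventually_remove_sings_eq_mero[OF assms]], simp)

lemmas remove_sings_ops =
  remove_sings_mult_left remove_sings_mult_right remove_sings_add_left remove_sings_add_right

lemma remove_sings_const: "remove_sings (\<lambda>_. c) = (\<lambda>_. c)"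
  by (rule nicely_mero_remove_sings[OF nicely_meromorphic_on_const])

lemma nicely_mero_inverse:
  assumes "f nicely_meromorphic_on UNIV" "f \<noteq> (\<lambda>_. 0)"
  shows "remove_sings (\<lambda>z. inverse (f z) * f z) = (\<lambda>_. 1)"
proof -
  have "\<exists>z. f z \<noteq> 0" using assms(2) by auto
  then have nc: "\<forall>\<^sub>F w in cosparse UNIV. f w \<noteq> 0"
    using nicely_meromorphic_imp_constant_or_avoid[OF assms(1), of 0] by auto
  have "\<forall>\<^sub>F w in at z. inverse (f w) * f w = 1" for z
  proof -
    have "\<forall>\<^sub>F w in at z. f w \<noteq> 0"
      using nc by (simp add: eventually_cosparse_open_eq)
    then show ?thesis by eventually_elim simp
  qed
  then have "remove_sings (\<lambda>z. inverse (f z) * f z) = remove_sings (\<lambda>_. 1)"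
    by (rule remove_sings_eqI_at)
  then show ?thesis by (simp add: remove_sings_const)
qed

theorem field_mero: "field mero"
proof (rule cring.cring_fieldI2)
  show "cring mero"
  proof (rule cringI)
    show "abelian_group mero"
    proof (rule abelian_groupI)
      fix x assume "x \<in> carrier mero"
      then have x: "x nicely_meromorphic_on UNIV" by (simp add: mero_def)
      show "\<exists>y\<in>carrier mero. y \<oplus>\<^bsub>mero\<^esub> x = \<zero>\<^bsub>mero\<^esub>"
        by (rule bexI[of _ "\<lambda>z. - x z"])
           (use x in \<open>auto simp: mero_def remove_sings_const nicely_meromorphic_on_uminus\<close>)
    qed (auto simp: mero_def remove_sings_ops nice_imp_mero meromorphic_on_add
           nicely_mero_remove_sings algebra_simps intro!: remove_sings_nicely_meromorphic)
    show "Group.comm_monoid mero"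
      by (rule comm_monoidI)
        (auto simp: mero_def remove_sings_ops nice_imp_mero meromorphic_on_mult
           nicely_mero_remove_sings algebra_simps intro!: remove_sings_nicely_meromorphic)
  qed (auto simp: mero_def remove_sings_ops nice_imp_mero meromorphic_on_mult meromorphic_on_add
           nicely_mero_remove_sings algebra_simps)
next
  show "\<zero>\<^bsub>mero\<^esub> \<noteq> \<one>\<^bsub>mero\<^esub>" by (auto simp: mero_def fun_eq_iff)
next
  fix a assume a: "a \<in> carrier mero" "a \<noteq> \<zero>\<^bsub>mero\<^esub>"
  then have n: "a nicely_meromorphic_on UNIV" and nz: "a \<noteq> (\<lambda>_. 0)" by (auto simp: mero_def)
  have i: "(\<lambda>z. inverse (a z)) meromorphic_on UNIV"
    using n by (intro meromorphic_on_inverse nice_imp_mero)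
  show "\<exists>b\<in>carrier mero. a \<otimes>\<^bsub>mero\<^esub> b = \<one>\<^bsub>mero\<^esub>"
  proof (rule bexI[of _ "remove_sings (\<lambda>z. inverse (a z))"])
    show "a \<otimes>\<^bsub>mero\<^esub> remove_sings (\<lambda>z. inverse (a z)) = \<one>\<^bsub>mero\<^esub>"
      using nicely_mero_inverse[OF n nz]
      by (simp add: mero_def remove_sings_ops[OF i] mult.commute)
    show "remove_sings (\<lambda>z. inverse (a z)) \<in> carrier mero"
      using i by (simp add: mero_def remove_sings_nicely_meromorphic)
  qed
qed

end

theory Submission
  imports Defs "HOL-Real_Asymp.Real_Asymp"
begin

text \<open>
  Why the statement holds. Write \<open>m(r,g)\<close> for the proximity term and \<open>n(r,g)\<close> for the number of
  poles in the disc of radius \<open>r\<close>. A function lies in $M_{<1}$ exactly when both are \<open>o(r)\<close>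
  (\<open>mero_less_1_iff\<close>). Three things follow from this description.

  First, $M_{<1}$ is a field stable under the shift. Sums and products are elementary, and the
  reciprocal is Jensen's formula: passing from \<open>g\<close> to \<open>1/g\<close> changes \<open>T(r,g)\<close> by a constant
  (\<open>first_main_theorem_reciprocal\<close>). The shift (\<open>mero_less_1_shift\<close>) is subtler, because \<open>m(r,g)\<close>
  refers to circles about the origin, and the shift asks for circles about 1. On a larger disc of
  radius \<open>R\<close> one writes \<open>log |g|\<close> as \<open>Re L\<close> plus a sum of terms \<open>\<plusminus> log (|z - a| / R)\<close> over zeros and
  poles. The explicit terms have bounded means on either circle, and \<open>L\<close> is controlled inside the
  disc by the mean of \<open>|Re L|\<close> on the boundary through the Schwarz integral formula
  (\<open>Schwarz_integral_bound\<close>).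

  Second, a non-zero element of $M_{<1}$ cannot vanish along \<open>z0, z0 + 1, z0 + 2, \<dots>\<close>, since its
  reciprocal would then have too many poles (\<open>mero_less_1_no_zero_progression\<close>). This gives part (1)
  by specialization. A periodic function is constant on \<open>z0 + \<nat>\<close>, so for all \<open>z0\<close> outside a countable
  set the element \<open>b\<close> of the compositum agrees on \<open>z0 + \<nat>\<close> with an element \<open>b'\<close> of $M_{<1}$: replace
  every periodic function in an expression for \<open>b\<close> by its value at \<open>z0\<close>
  (\<open>generic_specialization\<close>). Then \<open>\<phi>(b') - a b'\<close> belongs to $M_{<1}$ and vanishes on \<open>z0 + \<nat>\<close>, hence
  vanishes identically (\<open>exists_solution_less_1\<close>). If \<open>z0\<close> also avoids the zeros of \<open>b\<close>, then
  \<open>b'(z0) = b(z0)\<close> is not zero.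

  Third, \<open>b'\<close> is rational. Away from the finitely many zeros and poles of \<open>a\<close>, the divisor of \<open>b'\<close> is
  invariant under the shift, so a zero or pole of \<open>b'\<close> with large modulus would produce a whole
  arithmetic progression of them (\<open>finite_zeros_of_solution\<close>). Hence \<open>b'\<close> is a rational function times
  \<open>exp L\<close> with \<open>L\<close> entire, and the Schwarz bound applied on ever larger circles makes \<open>L\<close> constant
  (\<open>mero_less_1_finite_divisor_is_rational\<close>). Finally \<open>b / b'\<close> is fixed by the shift, which is part (2).
\<close>

section \<open>Means over circles\<close>

definition circle_mean :: "complex \<Rightarrow> real \<Rightarrow> (complex \<Rightarrow> real) \<Rightarrow> real" where
  "circle_mean c r u = 1 / (2 * pi) * integral {0..2 * pi} (\<lambda>\<theta>. u (c + of_real r * cis \<theta>))"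

text \<open>
  Absolute integrability is required, rather than integrability, so that \<open>|u|\<close> and \<open>max 0 u\<close> inherit
  it; the functions of interest have logarithmic singularities on the circle.
\<close>
definition circle_integrable :: "complex \<Rightarrow> real \<Rightarrow> (complex \<Rightarrow> real) \<Rightarrow> bool" where
  "circle_integrable c r u \<longleftrightarrow>
     (\<lambda>\<theta>. u (c + of_real r * cis \<theta>)) absolutely_integrable_on {0..2 * pi}"

text \<open>
  Finite sets of points on a circle are negligible for the angular measure. Hence zeros and poles on
  the circle of integration need no special treatment, and every radius is admissible below.
\<close>
lemma finite_circle_preimage:
  assumes "r \<noteq> 0" "finite A"
  shows "finite {\<theta> \<in> {0..2 * pi}. c + of_real r * cis \<theta> \<in> A}"
proof -
  have inj: "inj_on cis {0..<2 * pi}"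
  proof (rule inj_onI)
    fix x y assume xy: "x \<in> {0..<2 * pi}" "y \<in> {0..<2 * pi}" "cis x = cis y"
    then have "sin x = sin y" "cos x = cos y" by (auto simp: complex_eq_iff)
    then obtain n :: int where n: "x = y + 2 * pi * of_int n"
      using sin_cos_eq_iff by blast
    have "2 * pi * of_int n < 2 * pi * 1" "2 * pi * (- 1) < 2 * pi * of_int n"
      using xy n unfolding atLeastLessThan_iff by linarith+
    then have "real_of_int n < 1" "-1 < real_of_int n"
      by (simp_all only: mult_less_cancel_left_pos[of "2 * pi"] pi_gt_zero mult_pos_pos zero_less_numeral)
    then have "n = 0" by linarith
    with n show "x = y" by simp
  qed
  have "finite ((\<lambda>\<theta>. c + of_real r * cis \<theta>) -` A \<inter> {0..<2 * pi})"
    using inj assms by (intro finite_vimage_IntI) (auto simp: inj_on_def)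
  then have "finite (insert (2 * pi) ((\<lambda>\<theta>. c + of_real r * cis \<theta>) -` A \<inter> {0..<2 * pi}))"
    by simp
  then show ?thesis
    by (rule rev_finite_subset) auto
qed

lemma circle_integrable_cong:
  assumes "r \<noteq> 0" "finite A" "\<And>z. cmod (z - c) = \<bar>r\<bar> \<Longrightarrow> z \<notin> A \<Longrightarrow> u z = v z" "circle_integrable c r u"
  shows "circle_integrable c r v"
  unfolding circle_integrable_def
proof (rule absolutely_integrable_spike[OF assms(4)[unfolded circle_integrable_def]])
  show "negligible {\<theta> \<in> {0..2 * pi}. c + of_real r * cis \<theta> \<in> A}"
    by (intro negligible_finite finite_circle_preimage assms)
qed (use assms(3) in \<open>auto simp: norm_mult\<close>)

lemma circle_mean_cong:
  assumes "r \<noteq> 0" "finite A" "\<And>z. cmod (z - c) = \<bar>r\<bar> \<Longrightarrow> z \<notin> A \<Longrightarrow> u z = v z"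
  shows "circle_mean c r u = circle_mean c r v"
  unfolding circle_mean_def
proof (rule arg_cong[where f = "(*) (1 / (2 * pi))"], rule integral_spike)
  show "negligible {\<theta> \<in> {0..2 * pi}. c + of_real r * cis \<theta> \<in> A}"
    by (intro negligible_finite finite_circle_preimage assms)
qed (use assms(3) in \<open>auto simp: norm_mult\<close>)

lemma circle_integrable_integrable:
  "circle_integrable c r u \<Longrightarrow> (\<lambda>\<theta>. u (c + of_real r * cis \<theta>)) integrable_on {0..2 * pi}"
  unfolding circle_integrable_def by (rule set_lebesgue_integral_eq_integral(1))

lemma circle_integrable_const [simp]: "circle_integrable c r (\<lambda>_. k)"
  unfolding circle_integrable_def by (auto intro!: absolutely_integrable_continuous_real)

lemma circle_mean_const [simp]: "circle_mean c r (\<lambda>_. k) = k"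
  by (simp add: circle_mean_def)

lemma circle_integrable_add:
  "circle_integrable c r u \<Longrightarrow> circle_integrable c r v \<Longrightarrow> circle_integrable c r (\<lambda>z. u z + v z)"
  unfolding circle_integrable_def by (rule set_integral_add(1))

lemma circle_mean_add:
  "circle_integrable c r u \<Longrightarrow> circle_integrable c r v \<Longrightarrow>
     circle_mean c r (\<lambda>z. u z + v z) = circle_mean c r u + circle_mean c r v"
  unfolding circle_mean_def
  by (subst integral_add) (auto simp: add_divide_distrib intro: circle_integrable_integrable)

lemma circle_integrable_cmult:
  "circle_integrable c r u \<Longrightarrow> circle_integrable c r (\<lambda>z. k * u z)"
  unfolding circle_integrable_def by auto

lemma circle_mean_cmult: "circle_mean c r (\<lambda>z. k * u z) = k * circle_mean c r u"
  unfolding circle_mean_def by (simp add: algebra_simps)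

lemma circle_integrable_sum:
  "(\<And>i. i \<in> I \<Longrightarrow> circle_integrable c r (u i)) \<Longrightarrow> circle_integrable c r (\<lambda>z. \<Sum>i\<in>I. u i z)"
  by (induction I rule: infinite_finite_induct) (auto intro!: circle_integrable_add)

lemma circle_mean_sum:
  "(\<And>i. i \<in> I \<Longrightarrow> circle_integrable c r (u i)) \<Longrightarrow>
     circle_mean c r (\<lambda>z. \<Sum>i\<in>I. u i z) = (\<Sum>i\<in>I. circle_mean c r (u i))"
  by (induction I rule: infinite_finite_induct)
     (auto simp: circle_mean_add circle_integrable_sum)

lemma circle_integrable_abs:
  "circle_integrable c r u \<Longrightarrow> circle_integrable c r (\<lambda>z. \<bar>u z\<bar>)"
  unfolding circle_integrable_def using absolutely_integrable_norm by (fastforce simp: o_def)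

lemma circle_integrable_max_0:
  assumes "circle_integrable c r u"
  shows "circle_integrable c r (\<lambda>z. max 0 (u z))"
proof -
  have "(\<lambda>z. max 0 (u z)) = (\<lambda>z. 1/2 * (\<bar>u z\<bar> + u z))" by (auto simp: max_def)
  then show ?thesis
    by (simp only: ) (intro circle_integrable_cmult circle_integrable_add circle_integrable_abs assms)
qed

lemma circle_mean_mono:
  assumes "circle_integrable c r u" "circle_integrable c r v" "\<And>z. cmod (z - c) = \<bar>r\<bar> \<Longrightarrow> u z \<le> v z"
  shows "circle_mean c r u \<le> circle_mean c r v"
  unfolding circle_mean_def
  by (intro mult_left_mono integral_le circle_integrable_integrable assms)
     (auto simp: norm_mult)

lemma circle_mean_nonneg:
  assumes "\<And>z. u z \<ge> 0"
  shows "circle_mean c r u \<ge> 0"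
proof (cases "(\<lambda>\<theta>. u (c + of_real r * cis \<theta>)) integrable_on {0..2 * pi}")
  case True
  then show ?thesis
    unfolding circle_mean_def using assms
    by (intro mult_nonneg_nonneg Henstock_Kurzweil_Integration.integral_nonneg) auto
qed (simp add: circle_mean_def not_integrable_integral)

lemma circle_integrable_continuous:
  assumes "continuous_on {z. cmod (z - c) = \<bar>r\<bar>} u"
  shows "circle_integrable c r u"
  unfolding circle_integrable_def
  by (intro absolutely_integrable_continuous_real continuous_on_compose2[OF assms])
     (auto intro!: continuous_intros simp: norm_mult cis_conv_exp)

section \<open>The Schwarz integral formula\<close>

lemma Cauchy_integral_cis:
  fixes f :: "complex \<Rightarrow> complex"
  assumes "continuous_on (cball c r) f" "f holomorphic_on ball c r" "w \<in> ball c r"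
  shows "((\<lambda>\<theta>. f (c + of_real r * cis \<theta>) * (of_real r * cis \<theta> / (c + of_real r * cis \<theta> - w))) has_integral
           2 * pi * f w) {0..2 * pi}"
proof -
  have "((\<lambda>u. f u / (u - w)) has_contour_integral 2 * of_real pi * \<i> * f w) (part_circlepath c r 0 (2 * pi))"
    using Cauchy_integral_circlepath[OF assms(1,2), of w] assms(3)
    by (simp add: circlepath_def dist_norm norm_minus_commute)
  then have "((\<lambda>t. f (c + r * cis t) / (c + r * cis t - w) * r * \<i> * cis t) has_integral
      2 * of_real pi * \<i> * f w) {0..2 * pi}"
    by (subst (asm) has_contour_integral_part_circlepath_iff) auto
  from has_integral_mult_right[OF this, of "-\<i>"] show ?thesis
    by (simp add: algebra_simps)
qed

lemma circle_mean_Re_holomorphic: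
  assumes "f holomorphic_on S" "open S" "cball c r \<subseteq> S" "r > 0"
  shows "circle_integrable c r (\<lambda>z. Re (f z))" "circle_mean c r (\<lambda>z. Re (f z)) = Re (f c)"
proof -
  have cont: "continuous_on (cball c r) f" and hol: "f holomorphic_on ball c r"
    using assms by (auto intro!: holomorphic_on_imp_continuous_on elim!: holomorphic_on_subset)
  have "((\<lambda>\<theta>. f (c + of_real r * cis \<theta>)) has_integral 2 * pi * f c) {0..2 * pi}"
    using Cauchy_integral_cis[OF cont hol, of c] \<open>r > 0\<close> by simp
  from has_integral_Re[OF this]
  show "circle_mean c r (\<lambda>z. Re (f z)) = Re (f c)"
    by (simp add: circle_mean_def integral_unique)
  show "circle_integrable c r (\<lambda>z. Re (f z))"
    by (rule circle_integrable_continuous)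
       (use assms in \<open>auto intro!: continuous_intros continuous_on_subset[OF cont] simp: dist_norm norm_minus_commute\<close>)
qed

text \<open>
  Cauchy's formula on the circle \<open>w = R e\<^sup>i\<^sup>\<theta>\<close> gives \<open>f z - f 0\<close> as the mean of \<open>f w * k\<close> with
  \<open>k = z / (w - z)\<close>. The mean of \<open>cnj (f w) * k\<close> is zero: on the circle \<open>cnj k\<close> coincides with the
  function \<open>cnj z * w / (R\<^sup>2 - cnj z * w)\<close>, which is holomorphic in the disc and vanishes at the origin.
  Adding the two leaves only the real part of \<open>f\<close>, and \<open>|k| \<le> |z| / (R - |z|)\<close>.
\<close>
lemma Schwarz_integral_bound:
  assumes "f holomorphic_on S" "open S" "cball 0 R \<subseteq> S" "cmod z < R"
  shows "cmod (f z - f 0) \<le> 2 * cmod z / (R - cmod z) * circle_mean 0 R (\<lambda>w. \<bar>Re (f w)\<bar>)"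
proof -
  have "R > 0" using assms(4) norm_ge_zero[of z] by linarith
  have cont: "continuous_on (cball 0 R) f" and hol: "f holomorphic_on ball 0 R"
    using assms by (auto intro!: holomorphic_on_imp_continuous_on elim!: holomorphic_on_subset)
  define k where "k = (\<lambda>\<theta>. z / (of_real R * cis \<theta> - z))"
  have ne: "of_real R * cis \<theta> - z \<noteq> 0" for \<theta>
  proof
    assume "of_real R * cis \<theta> - z = 0"
    then have "cmod z = cmod (of_real R * cis \<theta>)" by simp
    then show False using assms(4) \<open>R > 0\<close> by (simp add: norm_mult)
  qed
  have ne': "of_real R - cnj z * cis \<theta> \<noteq> 0" for \<theta>
  proof
    assume "of_real R - cnj z * cis \<theta> = 0"
    then have "cmod (of_real R) = cmod (cnj z * cis \<theta>)" by simp
    then show False using assms(4) \<open>R > 0\<close> by (simp add: norm_mult)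
  qed
  have "((\<lambda>\<theta>. f (of_real R * cis \<theta>) * (of_real R * cis \<theta> / (of_real R * cis \<theta> - z)) - f (of_real R * cis \<theta>)) has_integral
           2 * pi * f z - 2 * pi * f 0) {0..2 * pi}"
    using Cauchy_integral_cis[OF cont hol, of z] Cauchy_integral_cis[OF cont hol, of 0] assms(4) \<open>R > 0\<close>
    by (intro has_integral_diff) auto
  then have 1: "((\<lambda>\<theta>. f (of_real R * cis \<theta>) * k \<theta>) has_integral 2 * pi * (f z - f 0)) {0..2 * pi}"
    using ne by (simp add: k_def field_simps)
  have "((\<lambda>\<theta>. (f (0 + of_real R * cis \<theta>) * (cnj z * (of_real R * cis \<theta>) / (of_real (R^2) - cnj z * (of_real R * cis \<theta>)))) *
           (of_real R * cis \<theta> / (of_real R * cis \<theta> - 0))) has_integral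
           2 * pi * (f 0 * (cnj z * 0 / (of_real (R^2) - cnj z * 0)))) {0..2 * pi}"
  proof -
    have *: "of_real (R^2) - cnj z * x \<noteq> 0" if "cmod x \<le> R" for x
    proof
      assume "of_real (R^2) - cnj z * x = 0"
      then have "cmod (of_real (R^2)) = cmod (cnj z * x)" by simp
      then have "R * R = cmod z * cmod x" using \<open>R > 0\<close> by (simp only: norm_of_real norm_mult complex_mod_cnj power2_eq_square abs_mult abs_of_pos)
      moreover have "cmod z * cmod x \<le> cmod z * R" using that by (intro mult_left_mono) auto
      moreover have "cmod z * R < R * R" using assms(4) \<open>R > 0\<close> by simp
      ultimately show False by linarith
    qed
    define F where "F = (\<lambda>x. f x * (cnj z * x / (of_real (R^2) - cnj z * x)))"
    have "continuous_on (cball 0 R) F" "F holomorphic_on ball 0 R"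
      unfolding F_def using * cont hol
      by (auto intro!: continuous_intros holomorphic_intros simp del: of_real_power)
    from Cauchy_integral_cis[OF this, of 0] \<open>R > 0\<close> show ?thesis
      by (simp add: F_def del: of_real_power)
  qed
  then have "((\<lambda>\<theta>. f (of_real R * cis \<theta>) * (cnj z * (of_real R * cis \<theta>) / (of_real (R^2) - cnj z * (of_real R * cis \<theta>)))) has_integral 0) {0..2 * pi}"
    using \<open>R > 0\<close> by simp
  also have "(\<lambda>\<theta>. f (of_real R * cis \<theta>) * (cnj z * (of_real R * cis \<theta>) / (of_real (R^2) - cnj z * (of_real R * cis \<theta>))))
     = (\<lambda>\<theta>. f (of_real R * cis \<theta>) * cnj (k \<theta>))"
  proof
    fix \<theta>
    have "of_real (R^2) - cnj z * (of_real R * cis \<theta>) = of_real R * (of_real R - cnj z * cis \<theta>)"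
      by (simp add: power2_eq_square algebra_simps)
    then have "cnj z * (of_real R * cis \<theta>) / (of_real (R^2) - cnj z * (of_real R * cis \<theta>)) =
        cnj z * cis \<theta> / (of_real R - cnj z * cis \<theta>)"
      using \<open>R > 0\<close> by simp
    also have "\<dots> = cnj z / (of_real R * cnj (cis \<theta>) - cnj z)"
    proof -
      have "(of_real R * cnj (cis \<theta>) - cnj z) * cis \<theta> = of_real R - cnj z * cis \<theta>"
        by (simp add: algebra_simps cis_cnj flip: cis_mult) (simp add: cis_mult)
      then show ?thesis
        by (metis cis_neq_zero mult_divide_mult_cancel_right)
    qed
    also have "\<dots> = cnj (k \<theta>)" by (simp add: k_def)
    finally show "f (of_real R * cis \<theta>) * (cnj z * (of_real R * cis \<theta>) / (of_real (R^2) - cnj z * (of_real R * cis \<theta>)))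
     = f (of_real R * cis \<theta>) * cnj (k \<theta>)" by simp
  qed
  finally have "((\<lambda>\<theta>. cnj (f (of_real R * cis \<theta>)) * k \<theta>) has_integral 0) {0..2 * pi}"
    using has_integral_cnj[of "\<lambda>\<theta>. f (of_real R * cis \<theta>) * cnj (k \<theta>)" 0] by (simp add: o_def)
  from has_integral_add[OF 1 this]
  have I: "((\<lambda>\<theta>. of_real (2 * Re (f (of_real R * cis \<theta>))) * k \<theta>) has_integral 2 * pi * (f z - f 0)) {0..2 * pi}"
    by (simp add: complex_add_cnj flip: distrib_right)
  define B where "B = cmod z / (R - cmod z)"
  have kB: "cmod (k \<theta>) \<le> B" for \<theta>
  proof -
    have "R - cmod z \<le> cmod (of_real R * cis \<theta> - z)"
      using norm_triangle_ineq2[of "of_real R * cis \<theta>" z] \<open>R > 0\<close> by (simp add: norm_mult)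
    then show ?thesis unfolding k_def B_def norm_divide
      using assms(4) by (intro divide_left_mono mult_pos_pos) auto
  qed
  have "circle_integrable 0 R (\<lambda>w. Re (f w))"
    by (rule circle_mean_Re_holomorphic) (use assms \<open>R > 0\<close> in auto)
  then have ci: "circle_integrable 0 R (\<lambda>w. (2 * B) * \<bar>Re (f w)\<bar>)"
    by (intro circle_integrable_cmult circle_integrable_abs)
  have "cmod (2 * pi * (f z - f 0)) \<le> integral {0..2*pi} (\<lambda>\<theta>. (2 * B) * \<bar>Re (f (0 + of_real R * cis \<theta>))\<bar>)"
  proof -
    have "cmod (integral {0..2*pi} (\<lambda>\<theta>. of_real (2 * Re (f (of_real R * cis \<theta>))) * k \<theta>)) \<le>
        integral {0..2*pi} (\<lambda>\<theta>. (2 * B) * \<bar>Re (f (0 + of_real R * cis \<theta>))\<bar>)"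
    proof (rule integral_norm_bound_integral)
      fix \<theta>
      have "\<bar>Re (f (of_real R * cis \<theta>))\<bar> * cmod (k \<theta>) \<le> \<bar>Re (f (of_real R * cis \<theta>))\<bar> * B"
        using kB by (intro mult_left_mono) auto
      then show "cmod (of_real (2 * Re (f (of_real R * cis \<theta>))) * k \<theta>) \<le> (2 * B) * \<bar>Re (f (0 + of_real R * cis \<theta>))\<bar>"
        by (simp add: norm_mult mult_ac)
    qed (use I circle_integrable_integrable[OF ci] in auto)
    with I show ?thesis by (simp add: integral_unique)
  qed
  also have "\<dots> = 2 * pi * circle_mean 0 R (\<lambda>w. (2 * B) * \<bar>Re (f w)\<bar>)"
    by (simp add: circle_mean_def)
  also have "\<dots> = 2 * pi * (2 * B * circle_mean 0 R (\<lambda>w. \<bar>Re (f w)\<bar>))"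
    by (simp only: circle_mean_cmult)
  finally have "2 * pi * cmod (f z - f 0) \<le> 2 * pi * (2 * B * circle_mean 0 R (\<lambda>w. \<bar>Re (f w)\<bar>))"
    by (simp add: norm_mult)
  then have "cmod (f z - f 0) \<le> 2 * B * circle_mean 0 R (\<lambda>w. \<bar>Re (f w)\<bar>)"
    by (simp only: mult_le_cancel_left_pos pi_gt_zero mult_pos_pos zero_less_numeral)
  then show ?thesis by (simp add: B_def)
qed

section \<open>The mean of log |z - a| over a circle\<close>

lemma ln_kernel_inside:
  assumes "cmod q < 1"
  shows "circle_integrable 0 1 (\<lambda>z. ln (cmod (1 - q * z)))" "circle_mean 0 1 (\<lambda>z. ln (cmod (1 - q * z))) = 0"
proof -
  have pos: "Re (1 - q * z) > 0" if "cmod z * cmod q < 1" for z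
    using that complex_Re_le_cmod[of "q * z"] by (simp add: norm_mult mult.commute)
  have op: "open {z. cmod z * cmod q < 1}"
    by (intro open_Collect_less continuous_intros)
  have hol: "(\<lambda>z. Ln (1 - q * z)) holomorphic_on {z. cmod z * cmod q < 1}"
    by (intro holomorphic_intros) (use pos in \<open>auto simp: complex_nonpos_Reals_iff not_le\<close>)
  have sub: "cball 0 1 \<subseteq> {z. cmod z * cmod q < 1}"
  proof
    fix z assume "z \<in> cball (0::complex) 1"
    then have "cmod z * cmod q \<le> 1 * cmod q" by (intro mult_right_mono) auto
    with assms show "z \<in> {z. cmod z * cmod q < 1}" by simp
  qed
  have eq: "Re (Ln (1 - q * z)) = ln (cmod (1 - q * z))" if "cmod (z - 0) = \<bar>1\<bar>" for z
  proof -
    have "1 - q * z \<noteq> 0" using pos[of z] that assms by fastforce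
    then show ?thesis by (rule Re_Ln)
  qed
  show "circle_integrable 0 1 (\<lambda>z. ln (cmod (1 - q * z)))"
    by (rule circle_integrable_cong[OF _ _ _ circle_mean_Re_holomorphic(1)[OF hol op sub], where A = "{}"])
       (use eq in auto)
  show "circle_mean 0 1 (\<lambda>z. ln (cmod (1 - q * z))) = 0"
    using circle_mean_Re_holomorphic(2)[OF hol op sub] eq
    by (subst circle_mean_cong[where A = "{}" and v = "\<lambda>z. Re (Ln (1 - q * z))"]) auto
qed

text \<open>
  For \<open>|q| = 1\<close> the integrand has a singularity on the circle. With \<open>s < 1\<close> increasing to 1 and
  \<open>x = Re (q z)\<close>, the quotient \<open>|1 - s q z|\<^sup>2 / (1 + s)\<^sup>2 = 1 - 2 (1 + x) s / (1 + s)\<^sup>2\<close> decreases in \<open>s\<close>,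
  so monotone convergence yields both integrability and the value, without an explicit majorant.
\<close>
lemma ln_kernel_boundary:
  assumes "cmod q = 1"
  shows "circle_integrable 0 1 (\<lambda>z. ln (cmod (1 - q * z)))" "circle_mean 0 1 (\<lambda>z. ln (cmod (1 - q * z))) = 0"
proof -
  \<comment> \<open>The singular angle is removed: there the limit function has the default value
    \<open>ln 0 = 0\<close>, which is not the limit.\<close>
  define S where "S = {0..2 * pi} - {\<theta> \<in> {0..2 * pi}. 0 + of_real 1 * cis \<theta> \<in> {inverse q}}"
  have neg: "negligible {\<theta> \<in> {0..2 * pi}. 0 + of_real 1 * cis \<theta> \<in> {inverse q}}"
    by (intro negligible_finite finite_circle_preimage) auto
  have q0: "q \<noteq> 0" using assms by auto
  have S_iff: "\<theta> \<in> S \<longleftrightarrow> \<theta> \<in> {0..2 * pi} \<and> q * cis \<theta> \<noteq> 1" for \<theta>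
    using q0 by (auto simp: S_def field_simps)
  have integral_S: "(f has_integral I) S \<longleftrightarrow> (f has_integral I) {0..2 * pi}" for f :: "real \<Rightarrow> real" and I
    by (rule has_integral_spike_set_eq; rule negligible_subset[OF neg]) (auto simp: S_def)
  define s where "s = (\<lambda>k::nat. 1 - 1 / (real k + 1))"
  have s: "0 \<le> s k" "s k < 1" "s k \<le> s (Suc k)" for k
    by (auto simp: s_def field_simps)
  have s_lim: "s \<longlonglongrightarrow> 1"
    unfolding s_def by (rule LIMSEQ_inverse_real_of_nat_add_minus[of 1, unfolded inverse_eq_divide, simplified, folded of_nat_Suc, THEN Lim_transform_eventually]) (auto simp: add_ac)
  define f where "f = (\<lambda>k \<theta>. ln (cmod (1 - of_real (s k) * q * cis \<theta>)) - ln (1 + s k))"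
  define g where "g = (\<lambda>\<theta>. ln (cmod (1 - q * cis \<theta>)) - ln 2)"
  have nz: "cmod (1 - of_real t * q * cis \<theta>) > 0" if "0 \<le> t" "t < 1" for t \<theta>
  proof -
    have "cmod (of_real t * q * cis \<theta>) < 1" using that assms by (simp add: norm_mult)
    then show ?thesis by (metis diff_0_right less_irrefl norm_one right_minus_eq zero_less_norm_iff)
  qed
  have int_f: "(f k has_integral - 2 * pi * ln (1 + s k)) S" for k
  proof -
    have c: "cmod (of_real (s k) * q) < 1" using s[of k] assms by (simp add: norm_mult)
    have "((\<lambda>\<theta>. ln (cmod (1 - of_real (s k) * q * cis \<theta>))) has_integral 0) {0..2 * pi}"
      using circle_integrable_integrable[OF ln_kernel_inside(1)[OF c]] ln_kernel_inside(2)[OF c]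
      by (simp add: circle_mean_def has_integral_integral)
    from has_integral_diff[OF this has_integral_const_real[of "ln (1 + s k)" 0 "2 * pi"]]
    show ?thesis by (simp add: f_def integral_S)
  qed
  have "g integrable_on S \<and> (\<lambda>k. integral S (f k)) \<longlonglongrightarrow> integral S g"
  proof (rule monotone_convergence_decreasing)
    show "f k integrable_on S" for k using int_f by blast
    show "f (Suc k) \<theta> \<le> f k \<theta>" if "\<theta> \<in> S" for k \<theta>
    proof -
      define x where "x = Re (q * cis \<theta>)"
      have x: "\<bar>x\<bar> \<le> 1" using abs_Re_le_cmod[of "q * cis \<theta>"] assms by (simp add: x_def norm_mult)
      have circ: "(Re (q * cis \<theta>))\<^sup>2 + (Im (q * cis \<theta>))\<^sup>2 = 1"
        using assms by (metis cmod_power2 mult_1 norm_cis norm_mult one_power2)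
      then have sq: "(cmod (1 - of_real t * q * cis \<theta>))\<^sup>2 = (1 + t)\<^sup>2 - 2 * t * (1 + x)" for t
      proof -
        have "(cmod (1 - of_real t * y))\<^sup>2 = (1 - t * Re y)\<^sup>2 + (t * Im y)\<^sup>2" for y
          unfolding cmod_power2 by simp
        from this[of "q * cis \<theta>"]
        have "(cmod (1 - of_real t * q * cis \<theta>))\<^sup>2 = (1 - t * x)\<^sup>2 + (t * Im (q * cis \<theta>))\<^sup>2"
          by (simp only: x_def mult.assoc)
        also have "\<dots> = 1 - 2 * t * x + t\<^sup>2 * (x\<^sup>2 + (Im (q * cis \<theta>))\<^sup>2)"
          by (simp add: power2_eq_square algebra_simps)
        also have "x\<^sup>2 + (Im (q * cis \<theta>))\<^sup>2 = 1" using circ by (simp only: x_def)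
        finally show ?thesis by (simp add: power2_eq_square algebra_simps)
      qed
      have expr: "f j \<theta> = 1 / 2 * ln (1 - 2 * (s j / (1 + s j)\<^sup>2) * (1 + x))" for j
      proof -
        have p: "1 + s j > 0" using s(1)[of j] by simp
        have "f j \<theta> = ln (cmod (1 - of_real (s j) * q * cis \<theta>) / (1 + s j))"
          unfolding f_def using nz[OF s(1,2), of j \<theta>] p by (simp add: ln_div)
        also have "\<dots> = 1 / 2 * ln ((cmod (1 - of_real (s j) * q * cis \<theta>) / (1 + s j))\<^sup>2)"
          using nz[OF s(1,2), of j \<theta>] p by (subst ln_realpow) auto
        also have "(cmod (1 - of_real (s j) * q * cis \<theta>) / (1 + s j))\<^sup>2 = 1 - 2 * (s j / (1 + s j)\<^sup>2) * (1 + x)"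
          using p by (simp add: power_divide sq diff_divide_distrib)
        finally show ?thesis .
      qed
      have pos: "1 - 2 * (s j / (1 + s j)\<^sup>2) * (1 + x) > 0" for j
      proof -
        have p: "1 + s j > 0" using s(1)[of j] by simp
        have "1 - 2 * (s j / (1 + s j)\<^sup>2) * (1 + x) = (cmod (1 - of_real (s j) * q * cis \<theta>))\<^sup>2 / (1 + s j)\<^sup>2"
          using p by (simp add: sq diff_divide_distrib)
        also have "\<dots> > 0" using nz[OF s(1,2), of j \<theta>] p by simp
        finally show ?thesis .
      qed
      have "s k / (1 + s k)\<^sup>2 \<le> s (Suc k) / (1 + s (Suc k))\<^sup>2"
      proof -
        have "s k * s (Suc k) \<le> 1" using s by (intro mult_le_one) (auto intro: less_imp_le)
        then have "0 \<le> (s (Suc k) - s k) * (1 - s k * s (Suc k))" using s[of k] by simp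
        then have "s k * (1 + s (Suc k))\<^sup>2 \<le> s (Suc k) * (1 + s k)\<^sup>2"
          by (simp add: power2_eq_square algebra_simps)
        then show ?thesis using s(1)[of k] s(1)[of "Suc k"] by (simp add: divide_simps)
      qed
      then have "1 - 2 * (s (Suc k) / (1 + s (Suc k))\<^sup>2) * (1 + x) \<le> 1 - 2 * (s k / (1 + s k)\<^sup>2) * (1 + x)"
        using x by (intro diff_left_mono mult_right_mono mult_left_mono) auto
      then show ?thesis
        unfolding expr using pos by (intro mult_left_mono ln_mono) auto
    qed
    show "(\<lambda>k. f k \<theta>) \<longlonglongrightarrow> g \<theta>" if "\<theta> \<in> S" for \<theta>
    proof -
      have "(\<lambda>k. f k \<theta>) \<longlonglongrightarrow> ln (cmod (1 - of_real 1 * q * cis \<theta>)) - ln (1 + 1)"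
        unfolding f_def by (intro tendsto_intros s_lim) (use that S_iff in auto)
      then show ?thesis by (simp add: g_def)
    qed
    have "range (\<lambda>k. integral S (f k)) \<subseteq> {- 2 * pi * ln 2..0}"
    proof (rule image_subsetI)
      fix k
      have "0 \<le> ln (1 + s k)" "ln (1 + s k) \<le> ln 2" using s(1,2)[of k] by (simp_all add: less_imp_le)
      then show "integral S (f k) \<in> {- 2 * pi * ln 2..0}"
        by (simp add: integral_unique[OF int_f])
    qed
    then show "bounded (range (\<lambda>k. integral S (f k)))"
      by (rule bounded_subset[OF bounded_closed_interval])
  qed
  moreover have "(\<lambda>k. integral S (f k)) \<longlonglongrightarrow> - 2 * pi * ln (1 + 1)"
    unfolding integral_unique[OF int_f] by (intro tendsto_intros s_lim) simp
  ultimately have "g integrable_on S" "integral S g = - 2 * pi * ln (1 + 1)"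
    using LIMSEQ_unique by blast+
  then have "(g has_integral - 2 * pi * ln 2) S"
    by (simp add: has_integral_iff)
  then have g: "(g has_integral - 2 * pi * ln 2) {0..2 * pi}" by (simp only: integral_S)
  have g_le: "g \<theta> \<le> 0" for \<theta>
  proof (cases "1 - q * cis \<theta> = 0")
    case False
    have "cmod (1 - q * cis \<theta>) \<le> 1 + cmod (q * cis \<theta>)"
      by (metis norm_one norm_triangle_ineq4)
    with False show ?thesis unfolding g_def using assms by (simp add: norm_mult)
  qed (simp add: g_def)
  have "(\<lambda>\<theta>. - g \<theta>) absolutely_integrable_on {0..2 * pi}"
    using g g_le by (intro nonnegative_absolutely_integrable_1) (auto simp: integrable_neg)
  then have "circle_integrable 0 1 (\<lambda>z. ln 2 - ln (cmod (1 - q * z)))"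
    by (simp add: circle_integrable_def g_def)
  from circle_integrable_cmult[OF this, of "-1"]
  have "circle_integrable 0 1 (\<lambda>z. ln (cmod (1 - q * z)) - ln 2)" by simp
  from circle_integrable_add[OF this circle_integrable_const[of _ _ "ln 2"]]
  show "circle_integrable 0 1 (\<lambda>z. ln (cmod (1 - q * z)))" by simp
  have "((\<lambda>\<theta>. ln (cmod (1 - q * cis \<theta>))) has_integral 0) {0..2 * pi}"
    using has_integral_add[OF g has_integral_const_real[of "ln 2" 0 "2 * pi"]] by (simp add: g_def)
  then show "circle_mean 0 1 (\<lambda>z. ln (cmod (1 - q * z))) = 0"
    by (simp add: circle_mean_def integral_unique)
qed

text \<open>
  Both cases of the maximum reduce to the kernel \<open>1 - q z\<close> on the unit circle: for \<open>w = a - c\<close> inside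
  the circle one reflects \<open>r e\<^sup>i\<^sup>\<theta> - w\<close> to \<open>r (1 - (cnj w / r) e\<^sup>i\<^sup>\<theta>)\<close>, which has the same modulus, and for
  \<open>w\<close> outside one factors out \<open>-w\<close>.
\<close>
lemma ln_norm_circle:
  assumes "r > 0"
  shows "circle_integrable c r (\<lambda>z. ln (cmod (z - a)))"
    and "circle_mean c r (\<lambda>z. ln (cmod (z - a))) = ln (max r (cmod (a - c)))"
proof -
  define w where "w = a - c"
  define m where "m = max r (cmod w)"
  have m: "m > 0" using assms by (simp add: m_def)
  obtain q where q: "cmod q \<le> 1"
    and eq: "\<And>\<theta>. cmod (c + of_real r * cis \<theta> - a) = m * cmod (1 - q * cis \<theta>)"
  proof (cases "cmod w \<le> r")
    case True
    have "cmod (c + of_real r * cis \<theta> - a) = m * cmod (1 - cnj w / of_real r * cis \<theta>)" for \<theta>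
    proof -
      have "cmod (of_real r * cis \<theta> - w) = cmod (cnj (of_real r * cis \<theta> - w))" by (simp only: complex_mod_cnj)
      also have "\<dots> = cmod ((of_real r * cis (- \<theta>) - cnj w) * cis \<theta>)" by (simp add: cis_cnj norm_mult)
      also have "(of_real r * cis (- \<theta>) - cnj w) * cis \<theta> = of_real r * (1 - cnj w / of_real r * cis \<theta>)"
        using assms by (simp add: algebra_simps cis_mult)
      finally have "cmod (of_real r * cis \<theta> - w) = r * cmod (1 - cnj w / of_real r * cis \<theta>)"
        using assms by (simp only: norm_mult norm_of_real abs_of_pos)
      moreover have "c + of_real r * cis \<theta> - a = of_real r * cis \<theta> - w" by (simp add: w_def)
      ultimately show ?thesis using True by (simp only: m_def max_absorb1)
    qed
    moreover have "cmod (cnj w / of_real r) \<le> 1" using True assms by (simp add: norm_divide)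
    ultimately show ?thesis using that by blast
  next
    case False
    then have w0: "w \<noteq> 0" using assms by auto
    have "cmod (c + of_real r * cis \<theta> - a) = m * cmod (1 - of_real r / w * cis \<theta>)" for \<theta>
    proof -
      have "of_real r * cis \<theta> - w = - w * (1 - of_real r / w * cis \<theta>)" using w0 by (simp add: algebra_simps)
      then have "cmod (of_real r * cis \<theta> - w) = cmod w * cmod (1 - of_real r / w * cis \<theta>)"
        by (simp add: norm_mult)
      moreover have "c + of_real r * cis \<theta> - a = of_real r * cis \<theta> - w" by (simp add: w_def)
      moreover have "m = cmod w" using False by (simp add: m_def)
      ultimately show ?thesis by (simp only:)
    qed
    moreover have "cmod (of_real r / w) \<le> 1" using False assms w0 by (simp add: norm_divide)
    ultimately show ?thesis using that by blast
  qed
  have k: "circle_integrable 0 1 (\<lambda>z. ln (cmod (1 - q * z)))" "circle_mean 0 1 (\<lambda>z. ln (cmod (1 - q * z))) = 0"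
    using q ln_kernel_inside[of q] ln_kernel_boundary[of q] by (cases "cmod q = 1"; force)+
  define u where "u = (\<lambda>z. ln (cmod (1 - q * z)) + ln m)"
  have u: "circle_integrable 0 1 u" "circle_mean 0 1 u = ln m"
    unfolding u_def using k by (auto simp: circle_mean_add intro!: circle_integrable_add)
  have fin: "negligible {\<theta> \<in> {0..2 * pi}. c + of_real r * cis \<theta> \<in> {a}}"
    using assms by (intro negligible_finite finite_circle_preimage) auto
  have ptw: "ln (cmod (c + of_real r * cis \<theta> - a)) = u (0 + of_real 1 * cis \<theta>)"
    if "\<theta> \<in> {0..2 * pi} - {\<theta> \<in> {0..2 * pi}. c + of_real r * cis \<theta> \<in> {a}}" for \<theta>
  proof -
    have "cmod (c + of_real r * cis \<theta> - a) > 0" using that by auto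
    then have "cmod (1 - q * cis \<theta>) > 0" unfolding eq using m by (simp add: zero_less_mult_iff)
    then show ?thesis unfolding u_def eq using m by (simp add: ln_mult)
  qed
  show "circle_integrable c r (\<lambda>z. ln (cmod (z - a)))"
    unfolding circle_integrable_def
    by (rule absolutely_integrable_spike[OF u(1)[unfolded circle_integrable_def] fin ptw])
  have "integral {0..2 * pi} (\<lambda>\<theta>. ln (cmod (c + of_real r * cis \<theta> - a))) =
      integral {0..2 * pi} (\<lambda>\<theta>. u (0 + of_real 1 * cis \<theta>))"
    by (rule integral_spike[OF fin ptw[symmetric]])
  with u(2) show "circle_mean c r (\<lambda>z. ln (cmod (z - a))) = ln (max r (cmod (a - c)))"
    by (simp add: circle_mean_def m_def w_def)
qed

section \<open>Zeros and poles of non-zero meromorphic functions\<close>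

lemma meromorphic_UNIV_singularity:
  assumes "f meromorphic_on UNIV"
  shows "isolated_singularity_at f z" "not_essential f z"
proof -
  have "f meromorphic_on {z}" using assms meromorphic_on_subset by blast
  then show "isolated_singularity_at f z" "not_essential f z"
    by (simp_all add: meromorphic_at_iff)
qed

definition mero_nz :: "(complex \<Rightarrow> complex) \<Rightarrow> bool" where
  "mero_nz g \<longleftrightarrow> g nicely_meromorphic_on UNIV \<and> g \<noteq> (\<lambda>_. 0)"

lemma mero_nzD:
  assumes "mero_nz g"
  shows "g nicely_meromorphic_on UNIV" "g \<noteq> (\<lambda>_. 0)" "g meromorphic_on A"
    "isolated_singularity_at g z" "not_essential g z"
proof -
  show 1: "g nicely_meromorphic_on UNIV" "g \<noteq> (\<lambda>_. 0)" using assms by (auto simp: mero_nz_def)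
  then have m: "g meromorphic_on UNIV" by (simp add: nice_imp_mero)
  then show "g meromorphic_on A" using meromorphic_on_subset by blast
  show "isolated_singularity_at g z" "not_essential g z"
    using meromorphic_UNIV_singularity[OF m] by auto
qed

lemma mero_nz_cosparse:
  assumes "mero_nz g"
  shows "eventually (\<lambda>z. g z \<noteq> 0) (cosparse UNIV)"
proof -
  have "\<exists>z. g z \<noteq> 0" using mero_nzD(2)[OF assms] by auto
  then show ?thesis
    using nicely_meromorphic_imp_constant_or_avoid[OF mero_nzD(1)[OF assms], of 0] by auto
qed

lemma mero_nz_eventually: "mero_nz g \<Longrightarrow> eventually (\<lambda>w. g w \<noteq> 0) (at z)"
  using mero_nz_cosparse[of g] by (simp add: eventually_cosparse_open_eq)

lemma mero_nz_frequently: "mero_nz g \<Longrightarrow> frequently (\<lambda>w. g w \<noteq> 0) (at z)"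
  by (simp add: mero_nz_eventually eventually_frequently)

lemma mero_nz_zeros_sparse: "mero_nz g \<Longrightarrow> {z. g z = 0} sparse_in UNIV"
  using mero_nz_cosparse[of g] by (simp add: eventually_cosparse)

lemma mero_nz_finite_zeros: "mero_nz g \<Longrightarrow> finite {z \<in> cball c r. g z = 0}"
  using sparse_in_compact_finite[OF sparse_in_subset[OF mero_nz_zeros_sparse], of g "cball c r"]
  by (simp add: Int_def)

lemma mero_nz_countable_zeros: "mero_nz g \<Longrightarrow> countable {z. g z = 0}"
  using sparse_imp_countable[OF open_UNIV mero_nz_zeros_sparse] by simp

text \<open>
  A nicely meromorphic function takes the value 0 at its poles. The set where \<open>g z = 0\<close> therefore
  collects the zeros and the poles of \<open>g\<close>; it is the support of the divisor, and it serves for \<open>g\<close> and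
  for \<open>1 / g\<close> at once.
\<close>
lemma mero_nz_zorder_eq_0_iff:
  assumes "mero_nz g"
  shows "zorder g z = 0 \<longleftrightarrow> g z \<noteq> 0"
proof (cases "is_pole g z")
  case True
  then have "zorder g z < 0" using isolated_pole_imp_neg_zorder mero_nzD(4)[OF assms] by blast
  moreover have "g z = 0" using is_pole_zero_at_nicely_mero[OF mero_nzD(1)[OF assms] True] by simp
  ultimately show ?thesis by simp
next
  case False
  then have "g analytic_on {z}"
    using nicely_meromorphic_on_imp_analytic_at[OF mero_nzD(1)[OF assms]] by simp
  then show ?thesis using zorder_eq_0_iff mero_nz_frequently[OF assms] by blast
qed

lemma mero_nz_is_pole_iff:
  assumes "mero_nz g"
  shows "is_pole g z \<longleftrightarrow> zorder g z < 0"
  using isolated_pole_imp_neg_zorder neg_zorder_imp_is_pole mero_nzD[OF assms] mero_nz_frequently[OF assms]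
  by blast

lemma mero_nz_inverse:
  assumes "mero_nz g"
  shows "mero_nz (\<lambda>z. inverse (g z))"
  using mero_nzD(1,2)[OF assms] unfolding mero_nz_def fun_eq_iff
  by (auto intro: nicely_meromorphic_on_inverse)

lemma mero_nz_zorder_inverse:
  assumes "mero_nz g"
  shows "zorder (\<lambda>z. inverse (g z)) z = - zorder g z"
  by (rule zorder_inverse) (use mero_nzD[OF assms] mero_nz_frequently[OF assms] in auto)

lemma mero_nz_mult:
  assumes "mero_nz f" "mero_nz g"
  shows "mero_nz (remove_sings (\<lambda>z. f z * g z))"
    "zorder (remove_sings (\<lambda>z. f z * g z)) z = zorder f z + zorder g z"
proof -
  have m: "(\<lambda>z. f z * g z) meromorphic_on UNIV"
    by (intro meromorphic_intros mero_nzD assms)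
  have "eventually (\<lambda>w. f w \<noteq> 0 \<and> g w \<noteq> 0 \<and> remove_sings (\<lambda>z. f z * g z) w = f w * g w) (at 0)"
    using mero_nz_eventually[OF assms(1), of 0] mero_nz_eventually[OF assms(2), of 0]
      eventually_remove_sings_eq_mero[OF m, of 0] by eventually_elim auto
  then obtain w where "remove_sings (\<lambda>z. f z * g z) w \<noteq> 0"
    using eventually_happens[of _ "at (0::complex)"] by fastforce
  then show "mero_nz (remove_sings (\<lambda>z. f z * g z))"
    using remove_sings_nicely_meromorphic[OF m] by (auto simp: mero_nz_def)
  have "zorder (remove_sings (\<lambda>z. f z * g z)) z = zorder (\<lambda>z. f z * g z) z"
    using meromorphic_UNIV_singularity[OF m] by simp
  also have "\<dots> = zorder f z + zorder g z"
    by (intro zorder_mult mero_nzD mero_nz_frequently assms)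
  finally show "zorder (remove_sings (\<lambda>z. f z * g z)) z = zorder f z + zorder g z" .
qed

lemma pole_count_eq_sum:
  assumes "mero_nz g" "finite A" "A \<subseteq> cball 0 t" "{z \<in> cball 0 t. g z = 0} \<subseteq> A"
  shows "pole_count t g = (\<Sum>a\<in>A. nat (- zorder g a))"
  unfolding pole_count_def
proof (rule sum.mono_neutral_left[OF assms(2)])
  show "{z. cmod z \<le> t \<and> is_pole g z} \<subseteq> A"
  proof
    fix z assume "z \<in> {z. cmod z \<le> t \<and> is_pole g z}"
    then have z: "cmod z \<le> t" "zorder g z < 0" using mero_nz_is_pole_iff[OF assms(1)] by auto
    then have "g z = 0" using mero_nz_zorder_eq_0_iff[OF assms(1), of z] by auto
    with z assms(4) show "z \<in> A" by auto
  qed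
qed (use assms(3) in \<open>auto simp: mero_nz_is_pole_iff[OF assms(1)]\<close>)

text \<open>
  Dividing out the divisor on \<open>S\<close> leaves a function of order 0 at every point of \<open>S\<close>, so its
  singularities there are removable and the extension has no zeros. For \<open>S\<close> a closed disc the result is
  local; for \<open>S = UNIV\<close> it describes functions with finite divisor.
\<close>
lemma mero_factorization:
  assumes g: "mero_nz g" and fin: "finite A" and A: "A = {z \<in> S. g z = 0}"
  obtains h where "h analytic_on S" "\<And>z. z \<in> S \<Longrightarrow> h z \<noteq> 0"
    "\<And>z. z \<in> S - A \<Longrightarrow> g z = h z * (\<Prod>a\<in>A. (z - a) powi zorder g a)"
proof -
  define P where "P = (\<lambda>z. \<Prod>a\<in>A. (z - a) powi zorder g a)"
  have P: "P meromorphic_on UNIV" unfolding P_def by (intro meromorphic_intros)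
  have fac: "(\<lambda>z. (z - a) powi zorder g a) meromorphic_on B" for a B
    by (intro meromorphic_intros)
  have P_nz: "eventually (\<lambda>z. P z \<noteq> 0) (at z)" for z
  proof -
    have "eventually (\<lambda>w. w \<notin> A - {z}) (at z)" "eventually (\<lambda>w. w \<noteq> z) (at z)"
      using islimpt_finite[of "A - {z}" z] fin
      by (auto simp: islimpt_iff_eventually eventually_at_filter)
    then show ?thesis
      by eventually_elim (use fin in \<open>auto simp: P_def power_int_eq_0_iff\<close>)
  qed
  have zP: "zorder P z = (if z \<in> A then zorder g z else 0)" for z
  proof -
    have "zorder P z = (\<Sum>a\<in>A. zorder (\<lambda>z. (z - a) powi zorder g a) z)"
      unfolding P_def by (rule zorder_prod) (use fac P_nz[unfolded P_def] in auto)
    also have "\<dots> = (\<Sum>a\<in>A. if a = z then zorder g a else 0)"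
    proof (rule sum.cong[OF refl])
      fix a assume "a \<in> A"
      show "zorder (\<lambda>z. (z - a) powi zorder g a) z = (if a = z then zorder g a else 0)"
      proof (cases "a = z")
        case True
        have "zorder (\<lambda>w. (w - z) powi zorder g a) z = zorder g a"
          by (rule zorder_eqI[of UNIV z "\<lambda>_. 1"]) auto
        with True show ?thesis by simp
      next
        case False
        then show ?thesis
          by (auto intro!: zorder_eq_0I analytic_intros simp: power_int_eq_0_iff)
      qed
    qed
    finally show ?thesis using fin by simp
  qed
  define H where "H = (\<lambda>z. g z / P z)"
  have mH: "H meromorphic_on UNIV" unfolding H_def by (intro meromorphic_intros P mero_nzD g)
  have H_nz: "eventually (\<lambda>z. H z \<noteq> 0) (at z)" for z
    using P_nz[of z] mero_nz_eventually[OF g, of z] by eventually_elim (simp add: H_def)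
  define h where "h = remove_sings H"
  have h: "mero_nz h"
  proof -
    have "eventually (\<lambda>w. h w \<noteq> 0) (at 0)"
      unfolding h_def using H_nz[of 0] eventually_remove_sings_eq_mero[OF mH, of 0] by eventually_elim simp
    then obtain w where "h w \<noteq> 0" using eventually_happens[of _ "at (0::complex)"] by fastforce
    then show ?thesis using remove_sings_nicely_meromorphic[OF mH] by (auto simp: mero_nz_def h_def)
  qed
  have zh: "zorder h z = zorder g z - (if z \<in> A then zorder g z else 0)" for z
  proof -
    have "zorder h z = zorder H z" using meromorphic_UNIV_singularity[OF mH] by (simp add: h_def)
    also have "\<dots> = zorder g z - zorder P z" unfolding H_def
      by (rule zorder_divide)
         (use P_nz[of z] mero_nzD(3)[OF g] mero_nz_frequently[OF g] meromorphic_on_subset[OF P, of "{z}"]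
          in \<open>auto simp: eventually_frequently\<close>)
    finally show ?thesis by (simp add: zP)
  qed
  have nz: "h z \<noteq> 0" if "z \<in> S" for z
  proof -
    have "zorder h z = 0" using zh[of z] mero_nz_zorder_eq_0_iff[OF g, of z] that A by auto
    then show ?thesis using mero_nz_zorder_eq_0_iff[OF h] by blast
  qed
  have ana: "h analytic_on {z}" if "z \<in> S" for z
  proof (rule nicely_meromorphic_on_imp_analytic_at[OF mero_nzD(1)[OF h]])
    show "\<not> is_pole h z"
      using nz[OF that] is_pole_zero_at_nicely_mero[OF mero_nzD(1)[OF h]] by blast
  qed auto
  show ?thesis
  proof (rule that[of h])
    show "h analytic_on S" using ana analytic_on_analytic_at[of h S] by blast
    show "h z \<noteq> 0" if "z \<in> S" for z using nz that .
    show "g z = h z * (\<Prod>a\<in>A. (z - a) powi zorder g a)" if z: "z \<in> S - A" for z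
    proof -
      have "g z \<noteq> 0" using z A by auto
      then have "\<not> is_pole g z" using is_pole_zero_at_nicely_mero[OF mero_nzD(1)[OF g]] by blast
      then have "g analytic_on {z}"
        using nicely_meromorphic_on_imp_analytic_at[OF mero_nzD(1)[OF g]] by simp
      moreover have "P analytic_on {z}" unfolding P_def using z
        by (intro analytic_intros) auto
      moreover have Pz: "P z \<noteq> 0" unfolding P_def using z fin by (auto simp: power_int_eq_0_iff)
      ultimately have "H analytic_on {z}" unfolding H_def by (intro analytic_intros) auto
      then have "h z = g z / P z" by (simp add: h_def H_def)
      with Pz show ?thesis by (simp add: P_def)
    qed
  qed
qed

section \<open>Jensen's formula\<close>

lemma ln_norm_powi_prod:
  fixes e :: "complex \<Rightarrow> int"
  assumes "x \<noteq> 0" "finite A" "z \<notin> A"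
  shows "ln (cmod (x * (\<Prod>a\<in>A. (z - a) powi e a))) = ln (cmod x) + (\<Sum>a\<in>A. of_int (e a) * ln (cmod (z - a)))"
proof -
  have "ln (cmod (\<Prod>a\<in>A. (z - a) powi e a)) = (\<Sum>a\<in>A. ln (cmod ((z - a) powi e a)))"
    unfolding prod_norm[symmetric] using assms by (intro ln_prod) (auto simp: power_int_eq_0_iff)
  also have "\<dots> = (\<Sum>a\<in>A. of_int (e a) * ln (cmod (z - a)))"
  proof (rule sum.cong[OF refl])
    fix a assume "a \<in> A"
    then have "cmod (z - a) > 0" using assms(3) by auto
    then show "ln (cmod ((z - a) powi e a)) = of_int (e a) * ln (cmod (z - a))"
      by (simp add: norm_power_int ln_powr flip: powr_real_of_int')
  qed
  moreover have "(\<Prod>a\<in>A. (z - a) powi e a) \<noteq> 0"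
    using assms by (auto simp: power_int_eq_0_iff)
  ultimately show ?thesis using assms by (simp add: norm_mult ln_mult)
qed

lemma circle_integrable_ln_mero:
  assumes "g nicely_meromorphic_on UNIV" "r > 0"
  shows "circle_integrable c r (\<lambda>z. ln (cmod (g z)))"
proof (cases "g = (\<lambda>_. 0)")
  case False
  with assms have g: "mero_nz g" by (simp add: mero_nz_def)
  define A where "A = {z \<in> cball c r. g z = 0}"
  have fin: "finite A" unfolding A_def by (rule mero_nz_finite_zeros[OF g])
  obtain h where h: "h analytic_on cball c r" "\<And>z. z \<in> cball c r \<Longrightarrow> h z \<noteq> 0"
    "\<And>z. z \<in> cball c r - A \<Longrightarrow> g z = h z * (\<Prod>a\<in>A. (z - a) powi zorder g a)"
    using mero_factorization[OF g fin A_def] by blast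
  have "circle_integrable c r (\<lambda>z. ln (cmod (h z)) + (\<Sum>a\<in>A. of_int (zorder g a) * ln (cmod (z - a))))"
  proof (intro circle_integrable_add circle_integrable_sum circle_integrable_cmult ln_norm_circle(1) assms)
    show "circle_integrable c r (\<lambda>z. ln (cmod (h z)))"
      using h(2) \<open>r > 0\<close>
      by (intro circle_integrable_continuous continuous_intros)
         (auto simp: dist_norm norm_minus_commute intro!: continuous_on_subset[OF analytic_imp_holomorphic[OF h(1), THEN holomorphic_on_imp_continuous_on]])
  qed
  then show ?thesis
  proof (rule circle_integrable_cong[OF _ fin, rotated 2])
    fix z assume z: "cmod (z - c) = \<bar>r\<bar>" "z \<notin> A"
    then have zc: "z \<in> cball c r" using assms(2) by (simp add: dist_norm norm_minus_commute)
    show "ln (cmod (h z)) + (\<Sum>a\<in>A. of_int (zorder g a) * ln (cmod (z - a))) = ln (cmod (g z))"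
      using h(3)[of z] h(2)[OF zc] z zc fin by (simp add: ln_norm_powi_prod)
  qed (use assms in auto)
qed auto

lemma log_plus_norm: "log_plus (cmod z) = max 0 (ln (cmod z))"
  by (cases "z = 0") (auto simp: log_plus_def max_def not_le)

lemma nev_proximity_eq: "nev_proximity r g = circle_mean 0 r (\<lambda>z. max 0 (ln (cmod (g z))))"
  by (simp add: nev_proximity_def circle_mean_def log_plus_norm cis_conv_exp)

lemma nev_proximity_nonneg: "nev_proximity r g \<ge> 0"
  unfolding nev_proximity_eq by (rule circle_mean_nonneg) simp

lemma holomorphic_log_exists:
  assumes "h holomorphic_on S" "open S" "convex S" "\<And>z. z \<in> S \<Longrightarrow> h z \<noteq> 0"
  obtains L where "L holomorphic_on S" "\<And>z. z \<in> S \<Longrightarrow> h z = exp (L z)"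
  using simply_connected_eq_holomorphic_log[OF assms(2)] convex_imp_simply_connected[OF assms(3)] assms
  by metis

text \<open>
  The logarithm is needed on an open disc strictly larger than the closed one, so that the mean value
  property and the Schwarz formula apply on the boundary circle.
\<close>
lemma analytic_log_cball:
  assumes "h analytic_on cball c r" "\<And>z. z \<in> cball c r \<Longrightarrow> h z \<noteq> 0" "r > 0"
  obtains \<rho> L where "\<rho> > r" "L holomorphic_on ball c \<rho>" "\<And>z. z \<in> ball c \<rho> \<Longrightarrow> h z = exp (L z)"
proof -
  obtain U where U: "open U" "cball c r \<subseteq> U" "h holomorphic_on U"
    using assms(1) analytic_on_holomorphic by auto
  have "open (U \<inter> h -` (- {0}))"
    by (intro continuous_open_preimage holomorphic_on_imp_continuous_on U) auto
  moreover have "cball c r \<subseteq> U \<inter> h -` (- {0})" using U assms(2) by auto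
  ultimately obtain e where e: "e > 0" "(\<Union>x\<in>cball c r. ball x e) \<subseteq> U \<inter> h -` (- {0})"
    using compact_subset_open_imp_ball_epsilon_subset[OF compact_cball] by metis
  have sub: "ball c (r + e) \<subseteq> U \<inter> h -` (- {0})"
  proof
    fix z assume z: "z \<in> ball c (r + e)"
    \<comment> \<open>The radial contraction of z moves it by less than e and lands in the closed disc.\<close>
    define x where "x = c + of_real (r / (r + e)) * (z - c)"
    have lt: "cmod (z - c) < r + e" using z by (simp add: dist_norm norm_minus_commute)
    have "cmod (x - c) = r / (r + e) * cmod (z - c)"
      unfolding x_def using assms(3) e(1) by (simp add: norm_mult del: of_real_divide)
    also have "\<dots> \<le> r / (r + e) * (r + e)" using lt assms(3) e(1) by (intro mult_left_mono) auto
    also have "\<dots> = r" using assms(3) e(1) by simp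
    finally have "x \<in> cball c r" by (simp add: dist_norm norm_minus_commute)
    moreover have "z \<in> ball x e"
    proof -
      have "1 - r / (r + e) = e / (r + e)" using assms(3) e(1) by (simp add: field_simps)
      moreover have "z - x = of_real (1 - r / (r + e)) * (z - c)"
        by (simp add: x_def algebra_simps del: of_real_divide)
      ultimately have "cmod (z - x) = e / (r + e) * cmod (z - c)"
        using assms(3) e(1) by (simp add: norm_mult del: of_real_divide of_real_diff)
      also have "\<dots> < e / (r + e) * (r + e)" using lt assms(3) e(1) by (intro mult_strict_left_mono) auto
      also have "\<dots> = e" using assms(3) e(1) by simp
      finally show ?thesis by (simp add: dist_norm norm_minus_commute)
    qed
    ultimately show "z \<in> U \<inter> h -` (- {0})" using e(2) by blast
  qed
  have "h holomorphic_on ball c (r + e)" using U(3) sub holomorphic_on_subset by blast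
  then obtain L where "L holomorphic_on ball c (r + e)" "\<And>z. z \<in> ball c (r + e) \<Longrightarrow> h z = exp (L z)"
    using holomorphic_log_exists[of h "ball c (r + e)"] sub by blast
  with that[of "r + e" L] e(1) show ?thesis by simp
qed

text \<open>
  The first non-zero Laurent coefficient at the origin. Defining it as a limit makes visible that it is
  the same for the factorizations of \<open>g\<close> on all discs.
\<close>
definition leading_coeff_0 :: "(complex \<Rightarrow> complex) \<Rightarrow> complex" where
  "leading_coeff_0 g = Lim (at 0) (\<lambda>z. g z * z powi (- zorder g 0))"

lemma leading_coeff_0_factorization:
  assumes "mero_nz g" "r > 0" "finite A" "A = {z \<in> cball 0 r. g z = 0}" "h analytic_on cball 0 r"
    "\<And>z. z \<in> cball 0 r - A \<Longrightarrow> g z = h z * (\<Prod>a\<in>A. (z - a) powi zorder g a)"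
  shows "leading_coeff_0 g = h 0 * (\<Prod>a\<in>A - {0}. (0 - a) powi zorder g a)"
  unfolding leading_coeff_0_def
proof (rule tendsto_Lim)
  have "isCont h 0" using analytic_on_subset[OF assms(5), of "{0}"] assms(2) by (intro analytic_at_imp_isCont) simp
  then have "((\<lambda>z. h z * (\<Prod>a\<in>A - {0}. (z - a) powi zorder g a)) \<longlongrightarrow>
      h 0 * (\<Prod>a\<in>A - {0}. (0 - a) powi zorder g a)) (at 0)"
  proof -
    assume "isCont h 0"
    then have "h \<midarrow>0\<rightarrow> h 0" by (simp add: isCont_def)
    moreover have "((\<lambda>z. \<Prod>a\<in>A - {0}. (z - a) powi zorder g a) \<longlongrightarrow> (\<Prod>a\<in>A - {0}. (0 - a) powi zorder g a)) (at 0)"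
    proof (rule tendsto_prod)
      fix a assume "a \<in> A - {0}"
      then have "0 - a \<noteq> 0" by simp
      then show "((\<lambda>z. (z - a) powi zorder g a) \<longlongrightarrow> (0 - a) powi zorder g a) (at 0)"
        by (intro tendsto_power_int tendsto_diff tendsto_ident_at tendsto_const)
    qed
    ultimately show ?thesis by (rule tendsto_mult)
  qed
  moreover have "eventually (\<lambda>z. h z * (\<Prod>a\<in>A - {0}. (z - a) powi zorder g a) = g z * z powi (- zorder g 0)) (at 0)"
  proof -
    have "eventually (\<lambda>z. z \<in> ball 0 r) (at (0::complex))"
      using assms(2) by (intro eventually_at_in_open') auto
    moreover have "eventually (\<lambda>z. g z \<noteq> 0) (at 0)" by (rule mero_nz_eventually[OF assms(1)])
    moreover have "eventually (\<lambda>z::complex. z \<noteq> 0) (at 0)" by (simp add: eventually_at_filter)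
    ultimately show ?thesis
    proof eventually_elim
      case (elim z)
      then have g: "g z = h z * (\<Prod>a\<in>A. (z - a) powi zorder g a)"
        by (intro assms(6)) (simp add: assms(4))
      show ?case
      proof (cases "0 \<in> A")
        case True
        have "(\<Prod>a\<in>A. (z - a) powi zorder g a) = z powi zorder g 0 * (\<Prod>a\<in>A - {0}. (z - a) powi zorder g a)"
          using prod.remove[OF assms(3) True, of "\<lambda>a. (z - a) powi zorder g a"] by simp
        then show ?thesis using elim g by (simp add: power_int_minus)
      next
        case False
        then have "zorder g 0 = 0" using assms(2,4) mero_nz_zorder_eq_0_iff[OF assms(1)] by auto
        then show ?thesis using g False by simp
      qed
    qed
  qed
  ultimately show "((\<lambda>z. g z * z powi - zorder g 0) \<longlongrightarrow> h 0 * (\<Prod>a\<in>A - {0}. (0 - a) powi zorder g a)) (at 0)"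
    by (rule Lim_transform_eventually)
qed auto

text \<open>
  The zero-free factor has an analytic logarithm, so the mean of its \<open>log |h|\<close> is the value at the
  centre. Every factor \<open>|z - a|\<close> has mean logarithm \<open>log r\<close>, as \<open>|a| \<le> r\<close>, points on the circle included.
\<close>
lemma Jensen_formula:
  assumes g: "mero_nz g" and r: "r > 0" and A: "A = {z \<in> cball 0 r. g z = 0}"
  shows "circle_mean 0 r (\<lambda>z. ln (cmod (g z))) = ln (cmod (leading_coeff_0 g)) +
     (\<Sum>a\<in>A - {0}. of_int (zorder g a) * ln (r / cmod a)) + of_int (zorder g 0) * ln r"
proof -
  have fin: "finite A" unfolding A by (rule mero_nz_finite_zeros[OF g])
  obtain h where h: "h analytic_on cball 0 r" "\<And>z. z \<in> cball 0 r \<Longrightarrow> h z \<noteq> 0"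
    "\<And>z. z \<in> cball 0 r - A \<Longrightarrow> g z = h z * (\<Prod>a\<in>A. (z - a) powi zorder g a)"
    using mero_factorization[OF g fin A] by blast
  obtain \<rho> L where L: "\<rho> > r" "L holomorphic_on ball 0 \<rho>" "\<And>z. z \<in> ball 0 \<rho> \<Longrightarrow> h z = exp (L z)"
    using analytic_log_cball[OF h(1,2) r] by blast
  have 0: "(0::complex) \<in> cball 0 r" using r by simp
  have sub: "cball 0 r \<subseteq> ball 0 \<rho>" using L(1) by auto
  have Re_L: "Re (L z) = ln (cmod (h z))" if "z \<in> cball 0 r" for z
    using L(3)[OF subsetD[OF sub that]] by (simp add: norm_exp_eq_Re)
  have intL: "circle_integrable 0 r (\<lambda>z. Re (L z))" and meanL: "circle_mean 0 r (\<lambda>z. Re (L z)) = ln (cmod (h 0))"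
    using circle_mean_Re_holomorphic[OF L(2) open_ball sub r] Re_L[OF 0] by auto
  have "circle_mean 0 r (\<lambda>z. ln (cmod (g z))) =
      circle_mean 0 r (\<lambda>z. Re (L z) + (\<Sum>a\<in>A. of_int (zorder g a) * ln (cmod (z - a))))"
  proof (rule circle_mean_cong[OF _ fin])
    fix z assume z: "cmod (z - 0) = \<bar>r\<bar>" "z \<notin> A"
    then have zc: "z \<in> cball 0 r" using r by simp
    show "ln (cmod (g z)) = Re (L z) + (\<Sum>a\<in>A. of_int (zorder g a) * ln (cmod (z - a)))"
      using h(3)[of z] h(2)[OF zc] z zc fin by (simp add: ln_norm_powi_prod Re_L)
  qed (use r in auto)
  also have "\<dots> = ln (cmod (h 0)) + (\<Sum>a\<in>A. of_int (zorder g a) * ln (max r (cmod (a - 0))))"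
    using r by (simp only: circle_mean_add circle_mean_sum circle_mean_cmult ln_norm_circle meanL
        intL circle_integrable_sum circle_integrable_cmult)
  also have "\<dots> = ln (cmod (h 0)) + (\<Sum>a\<in>A. of_int (zorder g a) * ln r)"
    by (intro arg_cong2[where f = "(+)"] sum.cong refl) (auto simp: A max_def)
  also have "(\<Sum>a\<in>A. of_int (zorder g a) * ln r) = (\<Sum>a\<in>A - {0}. of_int (zorder g a) * ln r) + of_int (zorder g 0) * ln r"
  proof (cases "0 \<in> A")
    case False
    then have "zorder g 0 = 0" using r A mero_nz_zorder_eq_0_iff[OF g] by auto
    with False show ?thesis by simp
  qed (simp add: sum.remove[OF fin])
  also have "(\<Sum>a\<in>A - {0}. of_int (zorder g a) * ln r) = (\<Sum>a\<in>A - {0}. of_int (zorder g a) * ln (r / cmod a))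
      + (\<Sum>a\<in>A - {0}. of_int (zorder g a) * ln (cmod (0 - a)))"
    unfolding sum.distrib[symmetric] using r by (intro sum.cong refl) (auto simp: ln_div algebra_simps)
  finally have 1: "circle_mean 0 r (\<lambda>z. ln (cmod (g z))) = ln (cmod (h 0)) + ((\<Sum>a\<in>A - {0}. of_int (zorder g a) * ln (r / cmod a))
      + (\<Sum>a\<in>A - {0}. of_int (zorder g a) * ln (cmod (0 - a))) + of_int (zorder g 0) * ln r)" .
  have "ln (cmod (leading_coeff_0 g)) = ln (cmod (h 0)) + (\<Sum>a\<in>A - {0}. of_int (zorder g a) * ln (cmod (0 - a)))"
    using leading_coeff_0_factorization[OF g r fin A h(1,3)] h(2)[OF 0] fin ln_norm_powi_prod[of "h 0" "A - {0}" 0] by simp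
  with 1 show ?thesis by simp
qed

section \<open>The counting function and the characteristic of a reciprocal\<close>

lemma has_integral_log_kernel:
  fixes r s :: real
  assumes "0 < s" "s \<le> r"
  shows "((\<lambda>t. if s \<le> t then 1 / t else 0) has_integral ln (r / s)) {0..r}"
proof -
  have "((\<lambda>t. 1 / t) has_integral ln r - ln s) {s..r}"
  proof (rule fundamental_theorem_of_calculus)
    fix x assume "x \<in> {s..r}"
    then show "(ln has_vector_derivative 1 / x) (at x within {s..r})"
      using assms(1) by (auto intro!: derivative_eq_intros simp flip: has_real_derivative_iff_has_vector_derivative)
  qed (use assms in auto)
  then have "((\<lambda>t. if t \<in> {s..r} then 1 / t else 0) has_integral ln (r / s)) {0..r}"
    using assms by (subst has_integral_restrict) (auto simp: ln_div)
  then show ?thesis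
    by (rule has_integral_eq[rotated]) auto
qed

lemma pole_count_0: "mero_nz g \<Longrightarrow> pole_count 0 g = nat (- zorder g 0)"
  using pole_count_eq_sum[of g "{0}" 0] by auto

text \<open>
  Each pole \<open>a\<close> enters the integrand as \<open>1 / t\<close> from \<open>t = |a|\<close> on, and contributes \<open>log (r / |a|)\<close>.
\<close>
lemma nev_counting_has_integral:
  assumes g: "mero_nz g" and r: "r > 0" and A: "A = {z \<in> cball 0 r. g z = 0}"
  shows "((\<lambda>t. (real (pole_count t g) - real (pole_count 0 g)) / t) has_integral
      (\<Sum>a\<in>A - {0}. real (nat (- zorder g a)) * ln (r / cmod a))) {0..r}"
proof -
  have fin: "finite A" unfolding A by (rule mero_nz_finite_zeros[OF g])
  have "((\<lambda>t. \<Sum>a\<in>A - {0}. real (nat (- zorder g a)) * (if cmod a \<le> t then 1 / t else 0)) has_integral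
      (\<Sum>a\<in>A - {0}. real (nat (- zorder g a)) * ln (r / cmod a))) {0..r}"
    using fin by (intro has_integral_sum has_integral_mult_right has_integral_log_kernel) (auto simp: A)
  then show ?thesis
  proof (rule has_integral_eq[rotated])
    fix t assume t: "t \<in> {0..r}"
    define B where "B = {a \<in> A. cmod a \<le> t}"
    have finB: "finite B" using fin by (simp add: B_def)
    have "real (pole_count t g) = (\<Sum>a\<in>B. real (nat (- zorder g a)))"
      using t by (subst pole_count_eq_sum[OF g finB]) (auto simp: B_def A)
    also have "\<dots> = (\<Sum>a\<in>B - {0}. real (nat (- zorder g a))) + real (nat (- zorder g 0))"
    proof (cases "0 \<in> B")
      case False
      then have "zorder g 0 = 0" using r t A mero_nz_zorder_eq_0_iff[OF g] by (auto simp: B_def)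
      with False show ?thesis by simp
    qed (simp add: sum.remove[OF finB])
    finally have "(real (pole_count t g) - real (pole_count 0 g)) / t = (\<Sum>a\<in>B - {0}. real (nat (- zorder g a)) * (1 / t))"
      by (simp add: pole_count_0[OF g] sum_distrib_right[symmetric] sum_divide_distrib)
    also have "\<dots> = (\<Sum>a\<in>B - {0}. real (nat (- zorder g a)) * (if cmod a \<le> t then 1 / t else 0))"
      by (intro sum.cong refl) (auto simp: B_def)
    also have "\<dots> = (\<Sum>a\<in>A - {0}. real (nat (- zorder g a)) * (if cmod a \<le> t then 1 / t else 0))"
      using fin by (intro sum.mono_neutral_left) (auto simp: B_def)
    finally show "(\<Sum>a\<in>A - {0}. real (nat (- zorder g a)) * (if cmod a \<le> t then 1 / t else 0)) =
        (real (pole_count t g) - real (pole_count 0 g)) / t" by simp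
  qed
qed

lemma nev_counting_eq_sum:
  assumes g: "mero_nz g" and r: "r > 0" and A: "A = {z \<in> cball 0 r. g z = 0}"
  shows "nev_counting r g = (\<Sum>a\<in>A - {0}. real (nat (- zorder g a)) * ln (r / cmod a)) + real (nat (- zorder g 0)) * ln r"
  unfolding nev_counting_def
  using nev_counting_has_integral[OF assms] by (simp add: integral_unique pole_count_0[OF g])

text \<open>
  Since \<open>log\<^sup>+ (1/x) = log\<^sup>+ x - log x\<close>, the proximity terms differ by the mean of \<open>log |g|\<close>, and the
  counting terms differ by the sum over zeros minus the sum over poles. Jensen's formula says that these
  two differences cancel up to the leading coefficient.
\<close>
lemma first_main_theorem_reciprocal:
  assumes g: "mero_nz g" and r: "r > 0"
  shows "nev_char r (\<lambda>z. inverse (g z)) = nev_char r g - ln (cmod (leading_coeff_0 g))"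
proof -
  define A where "A = {z \<in> cball 0 r. g z = 0}"
  have A': "A = {z \<in> cball 0 r. inverse (g z) = 0}" by (simp add: A_def)
  have int: "circle_integrable 0 r (\<lambda>z. ln (cmod (g z)))"
    by (rule circle_integrable_ln_mero[OF mero_nzD(1)[OF g] r])
  have nn: "real (nat e) * x = real (nat (- e)) * x + of_int e * x" for e x
    by (cases "e \<ge> 0") (simp_all add: algebra_simps)
  have "nev_proximity r (\<lambda>z. inverse (g z)) = circle_mean 0 r (\<lambda>z. max 0 (ln (cmod (g z))) + (-1) * ln (cmod (g z)))"
    unfolding nev_proximity_eq
    by (intro circle_mean_cong[where A = "{}"]) (use r in \<open>auto simp: norm_inverse ln_inverse max_def\<close>)
  also have "\<dots> = nev_proximity r g - circle_mean 0 r (\<lambda>z. ln (cmod (g z)))"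
    unfolding nev_proximity_eq
    by (subst circle_mean_add[OF circle_integrable_max_0[OF int] circle_integrable_cmult[OF int]])
       (simp only: circle_mean_cmult)
  also have "circle_mean 0 r (\<lambda>z. ln (cmod (g z))) = ln (cmod (leading_coeff_0 g)) +
     (\<Sum>a\<in>A - {0}. of_int (zorder g a) * ln (r / cmod a)) + of_int (zorder g 0) * ln r"
    by (rule Jensen_formula[OF g r A_def])
  finally have prox: "nev_proximity r (\<lambda>z. inverse (g z)) = nev_proximity r g - (ln (cmod (leading_coeff_0 g)) +
     (\<Sum>a\<in>A - {0}. of_int (zorder g a) * ln (r / cmod a)) + of_int (zorder g 0) * ln r)" .
  have "nev_counting r (\<lambda>z. inverse (g z)) =
      (\<Sum>a\<in>A - {0}. real (nat (zorder g a)) * ln (r / cmod a)) + real (nat (zorder g 0)) * ln r"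
    using nev_counting_eq_sum[OF mero_nz_inverse[OF g] r A'] by (simp add: mero_nz_zorder_inverse[OF g])
  also have "\<dots> = (\<Sum>a\<in>A - {0}. real (nat (- zorder g a)) * ln (r / cmod a) + of_int (zorder g a) * ln (r / cmod a))
      + (real (nat (- zorder g 0)) * ln r + of_int (zorder g 0) * ln r)"
    by (intro arg_cong2[where f = "(+)"] sum.cong refl nn)
  also have "\<dots> = nev_counting r g + (\<Sum>a\<in>A - {0}. of_int (zorder g a) * ln (r / cmod a)) + of_int (zorder g 0) * ln r"
    unfolding nev_counting_eq_sum[OF g r A_def] by (simp add: sum.distrib)
  finally show ?thesis using prox by (simp add: nev_char_def)
qed

section \<open>Characterization of $M_{<1}$ by proximity and pole count\<close>

lemma nev_counting_nonneg:
  assumes g: "mero_nz g" and r: "r \<ge> 1"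
  shows "nev_counting r g \<ge> 0"
  using r by (subst nev_counting_eq_sum[OF g _ refl])
    (auto intro!: add_nonneg_nonneg sum_nonneg mult_nonneg_nonneg simp: ln_ge_zero_iff)

text \<open>
  A pole in the disc of radius \<open>r\<close> contributes \<open>log (e r / |a|) \<ge> 1\<close> to the counting function at \<open>e r\<close>.
\<close>
lemma pole_count_le_nev_counting:
  assumes g: "mero_nz g" and r: "r \<ge> 1"
  shows "real (pole_count r g) \<le> nev_counting (exp 1 * r) g"
proof -
  define A where "A = {z \<in> cball 0 (exp 1 * r). g z = 0}"
  define B where "B = {z \<in> cball 0 r. g z = 0}"
  have fin: "finite A" "finite B" unfolding A_def B_def by (intro mero_nz_finite_zeros[OF g])+
  have e1: "(1::real) \<le> exp 1" by simp
  have "r * 1 \<le> r * exp 1" using r e1 by (intro mult_left_mono) auto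
  then have er: "r \<le> exp 1 * r" by (simp add: mult.commute)
  have BA: "B \<subseteq> A" using er by (auto simp: A_def B_def)
  have ln_er: "ln (exp 1 * r / s) \<ge> 1" if "0 < s" "s \<le> r" for s
  proof -
    have "exp 1 * r / s = exp 1 * (r / s)" by simp
    also have "ln \<dots> = 1 + ln (r / s)" using that by (subst ln_mult) auto
    finally show ?thesis using that by simp
  qed
  have "real (pole_count r g) = (\<Sum>a\<in>B. real (nat (- zorder g a)))"
    by (subst pole_count_eq_sum[OF g fin(2)]) (auto simp: B_def)
  also have "\<dots> = (\<Sum>a\<in>B - {0}. real (nat (- zorder g a)) * 1) + real (nat (- zorder g 0)) * 1"
  proof (cases "0 \<in> B")
    case False
    then have "zorder g 0 = 0" using r mero_nz_zorder_eq_0_iff[OF g] by (auto simp: B_def)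
    with False show ?thesis by simp
  qed (simp add: sum.remove[OF fin(2)])
  also have "\<dots> \<le> (\<Sum>a\<in>B - {0}. real (nat (- zorder g a)) * ln (exp 1 * r / cmod a)) + real (nat (- zorder g 0)) * ln (exp 1 * r)"
    using ln_er[of 1] r by (intro add_mono sum_mono mult_left_mono ln_er) (auto simp: B_def)
  also have "\<dots> \<le> (\<Sum>a\<in>A - {0}. real (nat (- zorder g a)) * ln (exp 1 * r / cmod a)) + real (nat (- zorder g 0)) * ln (exp 1 * r)"
    using fin BA by (intro add_mono sum_mono2 mult_nonneg_nonneg) (auto simp: A_def)
  also have "\<dots> = nev_counting (exp 1 * r) g"
    using r by (subst nev_counting_eq_sum[OF g _ A_def]) auto
  finally show ?thesis .
qed

text \<open>
  The range of integration is split at \<open>s\<close>; beyond \<open>s\<close> the integrand is at most \<open>\<delta>\<close>. Letting \<open>\<delta>\<close> tend to 0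
  turns \<open>n(r) = o(r)\<close> into \<open>N(r) = o(r)\<close>.
\<close>
lemma nev_counting_le:
  assumes g: "mero_nz g" and s: "s \<ge> 1" "s \<le> r" and \<delta>: "\<And>t. t \<ge> s \<Longrightarrow> real (pole_count t g) \<le> \<delta> * t"
  shows "nev_counting r g \<le> nev_counting s g + real (pole_count 0 g) * ln r + \<delta> * r"
proof -
  define f where "f = (\<lambda>t. (real (pole_count t g) - real (pole_count 0 g)) / t)"
  have int: "f integrable_on {0..r}"
    using nev_counting_has_integral[OF g _ refl, of r] s unfolding f_def by auto
  have \<delta>0: "\<delta> \<ge> 0"
  proof -
    have "0 \<le> \<delta> * s" using \<delta>[of s] by (meson of_nat_0_le_iff order_trans order_refl)
    then show ?thesis using s by (simp add: zero_le_mult_iff)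
  qed
  have "integral {0..r} f = integral {0..s} f + integral {s..r} f"
    using Henstock_Kurzweil_Integration.integral_combine[of 0 s r f] s int by simp
  also have "integral {s..r} f \<le> integral {s..r} (\<lambda>_. \<delta>)"
  proof (rule integral_le)
    show "f integrable_on {s..r}" using int by (rule integrable_on_subinterval) (use s in auto)
    fix t assume t: "t \<in> {s..r}"
    then have "f t \<le> real (pole_count t g) / t" using s by (auto simp: f_def intro!: divide_right_mono)
    also have "\<dots> \<le> \<delta>" using \<delta>[of t] t s by (simp add: field_simps)
    finally show "f t \<le> \<delta>" .
  qed auto
  also have "integral {s..r} (\<lambda>_. \<delta>) \<le> \<delta> * r" using s \<delta>0 by (simp add: algebra_simps)
  finally have "integral {0..r} f \<le> integral {0..s} f + \<delta> * r" by simp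
  moreover have "0 \<le> real (pole_count 0 g) * ln s" using s by simp
  ultimately show ?thesis by (simp add: nev_counting_def f_def)
qed

lemma smallo_id_dominated:
  fixes f h :: "real \<Rightarrow> real"
  assumes "eventually (\<lambda>r. \<bar>f r\<bar> \<le> h r) at_top" "h \<in> o(\<lambda>r. r)"
  shows "f \<in> o(\<lambda>r. r)"
  by (rule landau_o.big_small_trans[OF bigoI[of _ 1] assms(2)])
     (use assms(1) in \<open>auto elim!: eventually_mono\<close>)

lemma smallo_id_cmult:
  fixes f :: "real \<Rightarrow> real"
  assumes "f \<in> o(\<lambda>r. r)"
  shows "(\<lambda>r. c * f r) \<in> o(\<lambda>r. r)"
  using assms by (cases "c = 0") auto

lemma const_smallo_id: "(\<lambda>r::real. c) \<in> o(\<lambda>r. r)" for c :: real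
proof -
  have "(\<lambda>r::real. 1::real) \<in> o(\<lambda>r. r)" by real_asymp
  from smallo_id_cmult[OF this, of c] show ?thesis by simp
qed

lemma ln_smallo_id: "(\<lambda>r::real. ln r) \<in> o(\<lambda>r. r)"
  by real_asymp

lemma smallo_id_scale:
  fixes f :: "real \<Rightarrow> real"
  assumes "f \<in> o(\<lambda>r. r)" "k > 0"
  shows "(\<lambda>r. f (k * r + m)) \<in> o(\<lambda>r. r)"
proof -
  have "filterlim (\<lambda>r. k * r + m) at_top at_top" using assms(2) by real_asymp
  from landau_o.small.compose[OF assms(1) this]
  have "(\<lambda>r. f (k * r + m)) \<in> o(\<lambda>r. k * r + m)" .
  moreover have "(\<lambda>r. k * r + m) \<in> O(\<lambda>r. r)" by real_asymp
  ultimately show ?thesis by (rule landau_o.small_big_trans)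
qed

lemma nev_counting_smallo_iff:
  assumes g: "mero_nz g"
  shows "(\<lambda>r. nev_counting r g) \<in> o(\<lambda>r. r) \<longleftrightarrow> (\<lambda>r. real (pole_count r g)) \<in> o(\<lambda>r. r)"
proof
  assume N: "(\<lambda>r. nev_counting r g) \<in> o(\<lambda>r. r)"
  show "(\<lambda>r. real (pole_count r g)) \<in> o(\<lambda>r. r)"
  proof (rule smallo_id_dominated[OF _ smallo_id_scale[OF N, of "exp 1" 0]])
    show "\<forall>\<^sub>F r in at_top. \<bar>real (pole_count r g)\<bar> \<le> nev_counting (exp 1 * r + 0) g"
      using eventually_ge_at_top[of 1] by eventually_elim (simp add: pole_count_le_nev_counting[OF g])
  qed simp
next
  assume n: "(\<lambda>r. real (pole_count r g)) \<in> o(\<lambda>r. r)"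
  show "(\<lambda>r. nev_counting r g) \<in> o(\<lambda>r. r)"
  proof (rule landau_o.smallI)
    fix c :: real assume c: "c > 0"
    have "eventually (\<lambda>t. norm (real (pole_count t g)) \<le> c / 2 * norm t) at_top"
      using landau_o.smallD[OF n, of "c / 2"] c by simp
    then obtain s0 where s0: "\<And>t. t \<ge> s0 \<Longrightarrow> real (pole_count t g) \<le> c / 2 * \<bar>t\<bar>"
      by (auto simp: eventually_at_top_linorder)
    define s where "s = max 1 s0"
    have s: "s \<ge> 1" "\<And>t. t \<ge> s \<Longrightarrow> real (pole_count t g) \<le> c / 2 * t"
      using s0 by (fastforce simp: s_def)+
    have "(\<lambda>r. nev_counting s g + real (pole_count 0 g) * ln r) \<in> o(\<lambda>r. r)"
      by (intro sum_in_smallo smallo_id_cmult ln_smallo_id const_smallo_id)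
    from landau_o.smallD[OF this, of "c / 2"] c
    have "eventually (\<lambda>r. norm (nev_counting s g + real (pole_count 0 g) * ln r) \<le> c / 2 * norm r) at_top" by simp
    then show "eventually (\<lambda>r. norm (nev_counting r g) \<le> c * norm r) at_top"
      using eventually_ge_at_top[of s]
    proof eventually_elim
      case (elim r)
      have "nev_counting r g \<le> nev_counting s g + real (pole_count 0 g) * ln r + c / 2 * r"
        using nev_counting_le[OF g s(1) _ s(2)] elim by blast
      moreover have "nev_counting r g \<ge> 0" using elim s by (intro nev_counting_nonneg[OF g]) auto
      ultimately show ?case using elim s by (simp add: abs_if split: if_splits)
    qed
  qed
qed

text \<open>
  Both terms of the characteristic are non-negative for \<open>r \<ge> 1\<close>, so each is \<open>o(r)\<close> if the sum is. The gain
  over the definition is that pole counts can be compared pole by pole.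
\<close>
lemma mero_less_1_iff:
  assumes g: "mero_nz g"
  shows "g \<in> mero_less_1 \<longleftrightarrow>
    (\<lambda>r. nev_proximity r g) \<in> o(\<lambda>r. r) \<and> (\<lambda>r. real (pole_count r g)) \<in> o(\<lambda>r. r)"
proof -
  have "(\<lambda>r. nev_char r g) \<in> o(\<lambda>r. r) \<longleftrightarrow>
    (\<lambda>r. nev_proximity r g) \<in> o(\<lambda>r. r) \<and> (\<lambda>r. nev_counting r g) \<in> o(\<lambda>r. r)"
  proof
    assume T: "(\<lambda>r. nev_char r g) \<in> o(\<lambda>r. r)"
    have "eventually (\<lambda>r. \<bar>nev_proximity r g\<bar> \<le> nev_char r g \<and> \<bar>nev_counting r g\<bar> \<le> nev_char r g) at_top"
      using eventually_ge_at_top[of 1]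
      by eventually_elim (use nev_proximity_nonneg nev_counting_nonneg[OF g] in \<open>auto simp: nev_char_def\<close>)
    then show "(\<lambda>r. nev_proximity r g) \<in> o(\<lambda>r. r) \<and> (\<lambda>r. nev_counting r g) \<in> o(\<lambda>r. r)"
      by (intro conjI smallo_id_dominated[OF _ T]; eventually_elim; simp)
  next
    assume "(\<lambda>r. nev_proximity r g) \<in> o(\<lambda>r. r) \<and> (\<lambda>r. nev_counting r g) \<in> o(\<lambda>r. r)"
    then show "(\<lambda>r. nev_char r g) \<in> o(\<lambda>r. r)"
      unfolding nev_char_def by (intro sum_in_smallo) auto
  qed
  then show ?thesis
    using mero_nzD(1)[OF g] by (simp add: mero_less_1_def mero_def nev_counting_smallo_iff[OF g])
qed

lemma mero_less_1_inverse:
  assumes g: "mero_nz g" "g \<in> mero_less_1"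
  shows "(\<lambda>z. inverse (g z)) \<in> mero_less_1"
proof -
  have "(\<lambda>r. nev_char r g - ln (cmod (leading_coeff_0 g))) \<in> o(\<lambda>r. r)"
    using g(2) by (intro sum_in_smallo const_smallo_id) (simp add: mero_less_1_def)
  then have "(\<lambda>r. nev_char r (\<lambda>z. inverse (g z))) \<in> o(\<lambda>r. r)"
    by (subst landau_o.small.in_cong[OF eventually_mono[OF eventually_gt_at_top[of 0]]])
       (auto simp: first_main_theorem_reciprocal[OF g(1)])
  then show ?thesis
    using mero_nzD(1)[OF mero_nz_inverse[OF g(1)]] by (simp add: mero_less_1_def mero_def)
qed

section \<open>$M_{<1}$ is closed under the field operations\<close>

lemma circle_mean_mono_finite:
  assumes "circle_integrable c r u" "circle_integrable c r v" "r \<noteq> 0" "finite A"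
    "\<And>z. cmod (z - c) = \<bar>r\<bar> \<Longrightarrow> z \<notin> A \<Longrightarrow> u z \<le> v z"
  shows "circle_mean c r u \<le> circle_mean c r v"
proof -
  define w where "w = (\<lambda>z. if z \<in> A then v z else u z)"
  have w: "circle_integrable c r w" "circle_mean c r u = circle_mean c r w"
    using circle_integrable_cong[OF assms(3,4) _ assms(1), of w] circle_mean_cong[OF assms(3,4), of c u w]
    by (auto simp: w_def)
  have "circle_mean c r w \<le> circle_mean c r v"
    using assms(5) by (intro circle_mean_mono w(1) assms(2)) (auto simp: w_def)
  with w(2) show ?thesis by simp
qed

lemma mero_nz_analytic_at: "mero_nz g \<Longrightarrow> g z \<noteq> 0 \<Longrightarrow> g analytic_on {z}"
  using nicely_meromorphic_on_imp_analytic_at[of g UNIV z] is_pole_zero_at_nicely_mero[of g UNIV z]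
  by (auto simp: mero_nz_def)

lemma circle_integrable_proximity:
  "g nicely_meromorphic_on UNIV \<Longrightarrow> r > 0 \<Longrightarrow> circle_integrable c r (\<lambda>z. max 0 (ln (cmod (g z))))"
  by (intro circle_integrable_max_0 circle_integrable_ln_mero)

lemma zero_mem_mero_less_1: "(\<lambda>_. 0) \<in> mero_less_1"
proof -
  have "pole_count t (\<lambda>_. 0) = 0" for t by (simp add: pole_count_def)
  then have "nev_char r (\<lambda>_. 0) = 0" for r
    by (simp add: nev_char_def nev_counting_def nev_proximity_eq)
  then show ?thesis by (auto simp: mero_less_1_def mero_def)
qed

lemma pole_count_le_add:
  assumes "mero_nz k" "mero_nz f" "mero_nz g"
    "\<And>z. nat (- zorder k z) \<le> nat (- zorder f z) + nat (- zorder g z)"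
  shows "pole_count t k \<le> pole_count t f + pole_count t g"
proof -
  define A where "A = {z \<in> cball 0 t. k z = 0} \<union> {z \<in> cball 0 t. f z = 0} \<union> {z \<in> cball 0 t. g z = 0}"
  have A: "finite A" "A \<subseteq> cball 0 t"
    unfolding A_def using assms(1-3) mero_nz_finite_zeros by (blast, auto)
  have "pole_count t k = (\<Sum>a\<in>A. nat (- zorder k a))" "pole_count t f = (\<Sum>a\<in>A. nat (- zorder f a))"
    "pole_count t g = (\<Sum>a\<in>A. nat (- zorder g a))"
    using assms A by (auto intro!: pole_count_eq_sum simp: A_def)
  then show ?thesis using assms(4) by (simp add: sum_mono flip: sum.distrib)
qed

text \<open>
  Sums and products share this criterion: the polar order of \<open>k\<close> is at most the sum of the polar orders,
  and \<open>log\<^sup>+ |k|\<close> is at most the sum of the \<open>log\<^sup>+\<close> up to a constant. The second bound is only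
  required off the zeros and poles, where sums and products of representatives are the pointwise ones.
\<close>
lemma mero_less_1_of_additive_bounds:
  assumes k: "mero_nz k" and f: "mero_nz f" "f \<in> mero_less_1" and g: "mero_nz g" "g \<in> mero_less_1"
    and ord: "\<And>z. nat (- zorder k z) \<le> nat (- zorder f z) + nat (- zorder g z)"
    and bd: "\<And>z. k z \<noteq> 0 \<Longrightarrow> f z \<noteq> 0 \<Longrightarrow> g z \<noteq> 0 \<Longrightarrow>
      max 0 (ln (cmod (k z))) \<le> max 0 (ln (cmod (f z))) + max 0 (ln (cmod (g z))) + C"
  shows "k \<in> mero_less_1"
proof -
  have mf: "(\<lambda>r. nev_proximity r f) \<in> o(\<lambda>r. r)" "(\<lambda>r. real (pole_count r f)) \<in> o(\<lambda>r. r)"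
    and mg: "(\<lambda>r. nev_proximity r g) \<in> o(\<lambda>r. r)" "(\<lambda>r. real (pole_count r g)) \<in> o(\<lambda>r. r)"
    using f g by (simp_all add: mero_less_1_iff)
  have "nev_proximity r k \<le> nev_proximity r f + nev_proximity r g + C" if r: "r > 0" for r
  proof -
    define A where "A = {z \<in> cball 0 r. k z = 0} \<union> {z \<in> cball 0 r. f z = 0} \<union> {z \<in> cball 0 r. g z = 0}"
    have A: "finite A" unfolding A_def using k f(1) g(1) mero_nz_finite_zeros by blast
    note int = circle_integrable_proximity[OF mero_nzD(1) r]
    have "nev_proximity r k \<le> circle_mean 0 r (\<lambda>z. max 0 (ln (cmod (f z))) + max 0 (ln (cmod (g z))) + C)"
      unfolding nev_proximity_eq using r
      by (intro circle_mean_mono_finite[OF _ _ _ A] circle_integrable_add circle_integrable_const int k f g bd)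
         (auto simp: A_def)
    also have "\<dots> = nev_proximity r f + nev_proximity r g + C"
      unfolding nev_proximity_eq by (simp add: circle_mean_add circle_integrable_add int k f g)
    finally show ?thesis .
  qed
  then have "(\<lambda>r. nev_proximity r k) \<in> o(\<lambda>r. r)"
    by (intro smallo_id_dominated[OF eventually_mono[OF eventually_gt_at_top[of 0]]
          sum_in_smallo(1)[OF sum_in_smallo(1)[OF mf(1) mg(1)] const_smallo_id[of C]]])
       (simp add: nev_proximity_nonneg)
  moreover have "(\<lambda>r. real (pole_count r k)) \<in> o(\<lambda>r. r)"
    by (rule smallo_id_dominated[OF always_eventually sum_in_smallo(1)[OF mf(2) mg(2)]])
       (use pole_count_le_add[OF k f(1) g(1) ord] in \<open>simp flip: of_nat_add\<close>)
  ultimately show ?thesis by (simp add: mero_less_1_iff[OF k])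
qed

lemma mero_less_1_nz: "g \<in> mero_less_1 \<Longrightarrow> g \<noteq> (\<lambda>_. 0) \<Longrightarrow> mero_nz g"
  by (simp add: mero_less_1_def mero_nz_def mero_def)

lemma mero_less_1_mult:
  assumes "f \<in> mero_less_1" "g \<in> mero_less_1"
  shows "remove_sings (\<lambda>z. f z * g z) \<in> mero_less_1"
proof (cases "f = (\<lambda>_. 0) \<or> g = (\<lambda>_. 0)")
  case True
  then have "remove_sings (\<lambda>z. f z * g z) = (\<lambda>_. 0)" by (auto simp: remove_sings_const)
  then show ?thesis by (simp add: zero_mem_mero_less_1)
next
  case False
  then have f: "mero_nz f" and g: "mero_nz g" using assms mero_less_1_nz by auto
  show ?thesis
  proof (rule mero_less_1_of_additive_bounds[OF mero_nz_mult(1)[OF f g] f assms(1) g assms(2)])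
    show "nat (- zorder (remove_sings (\<lambda>z. f z * g z)) z) \<le> nat (- zorder f z) + nat (- zorder g z)" for z
      by (simp add: mero_nz_mult(2)[OF f g])
    fix z assume z: "f z \<noteq> 0" "g z \<noteq> 0"
    then have "(\<lambda>z. f z * g z) analytic_on {z}"
      by (intro analytic_intros mero_nz_analytic_at f g)
    then show "max 0 (ln (cmod (remove_sings (\<lambda>z. f z * g z) z))) \<le>
        max 0 (ln (cmod (f z))) + max 0 (ln (cmod (g z))) + 0"
      using z by (simp add: norm_mult ln_mult)
  qed
qed

lemma log_plus_add_le:
  "max 0 (ln (cmod (x + y))) \<le> max 0 (ln (cmod x)) + max 0 (ln (cmod y)) + ln 2"
proof (cases "x + y = 0")
  case False
  have mx: "ln (max 1 (cmod w)) = max 0 (ln (cmod w))" for w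
    by (cases "w = 0") (auto simp: max_def)
  have "cmod (x + y) \<le> cmod x + cmod y" by (rule norm_triangle_ineq)
  also have "\<dots> \<le> 2 * (max 1 (cmod x) * max 1 (cmod y))"
  proof -
    have "cmod x \<le> max 1 (cmod x) * max 1 (cmod y)" "cmod y \<le> max 1 (cmod x) * max 1 (cmod y)"
      using mult_mono[of "cmod x" "max 1 (cmod x)" 1 "max 1 (cmod y)"]
        mult_mono[of 1 "max 1 (cmod x)" "cmod y" "max 1 (cmod y)"] by auto
    then show ?thesis by simp
  qed
  finally have "ln (cmod (x + y)) \<le> ln (2 * (max 1 (cmod x) * max 1 (cmod y)))"
    using False by (intro ln_mono) auto
  also have "\<dots> = ln 2 + (ln (max 1 (cmod x)) + ln (max 1 (cmod y)))"
  proof -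
    have "ln (2 * (a * b)) = ln 2 + (ln a + ln b)" if "a > 0" "b > 0" for a b :: real
      using that by (simp add: ln_mult)
    then show ?thesis by (simp add: less_max_iff_disj)
  qed
  also have "\<dots> = ln 2 + (max 0 (ln (cmod x)) + max 0 (ln (cmod y)))" by (simp only: mx)
  finally have "ln (cmod (x + y)) \<le> ln 2 + (max 0 (ln (cmod x)) + max 0 (ln (cmod y)))" .
  moreover have "0 \<le> ln 2 + (max 0 (ln (cmod x)) + max 0 (ln (cmod y)))" by simp
  ultimately show ?thesis by (intro max.boundedI) linarith+
qed simp

lemma mero_less_1_add:
  assumes "f \<in> mero_less_1" "g \<in> mero_less_1"
  shows "remove_sings (\<lambda>z. f z + g z) \<in> mero_less_1"
proof -
  let ?k = "remove_sings (\<lambda>z. f z + g z)"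
  have nf: "f nicely_meromorphic_on UNIV" and ng: "g nicely_meromorphic_on UNIV"
    using assms by (auto simp: mero_less_1_def mero_def)
  consider "f = (\<lambda>_. 0)" | "g = (\<lambda>_. 0)" | "?k = (\<lambda>_. 0)" | "f \<noteq> (\<lambda>_. 0)" "g \<noteq> (\<lambda>_. 0)" "?k \<noteq> (\<lambda>_. 0)" by blast
  then show ?thesis
  proof cases
    case 4
    then have f: "mero_nz f" and g: "mero_nz g" using assms mero_less_1_nz by auto
    have m: "(\<lambda>z. f z + g z) meromorphic_on UNIV"
      by (intro meromorphic_intros mero_nzD f g)
    have k: "mero_nz ?k" using remove_sings_nicely_meromorphic[OF m] 4(3) by (simp add: mero_nz_def)
    show ?thesis
    proof (rule mero_less_1_of_additive_bounds[OF k f assms(1) g assms(2)])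
      fix z
      have "eventually (\<lambda>w. f w + g w \<noteq> 0) (at z)"
        using mero_nz_eventually[OF k, of z] eventually_remove_sings_eq_mero[OF m, of z]
        by eventually_elim simp
      then have "frequently (\<lambda>w. f w + g w \<noteq> 0) (at z)"
        by (simp add: eventually_frequently)
      then have "zorder (\<lambda>w. f w + g w) z \<ge> min (zorder f z) (zorder g z)"
        using zorder_add_ge[OF mero_nzD(3)[OF f] mero_nz_frequently[OF f] mero_nzD(3)[OF g] mero_nz_frequently[OF g]]
        by simp
      moreover have "zorder ?k z = zorder (\<lambda>w. f w + g w) z"
        using meromorphic_UNIV_singularity[OF m] by simp
      ultimately show "nat (- zorder ?k z) \<le> nat (- zorder f z) + nat (- zorder g z)"
        by (simp add: min_def split: if_splits)
    next
      fix z assume z: "f z \<noteq> 0" "g z \<noteq> 0"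
      then have "(\<lambda>z. f z + g z) analytic_on {z}"
        by (intro analytic_intros mero_nz_analytic_at f g)
      then show "max 0 (ln (cmod (?k z))) \<le> max 0 (ln (cmod (f z))) + max 0 (ln (cmod (g z))) + ln 2"
        using log_plus_add_le[of "f z" "g z"] by simp
    qed
  qed (use assms nicely_mero_remove_sings[OF nf] nicely_mero_remove_sings[OF ng] in \<open>auto simp: zero_mem_mero_less_1\<close>)
qed

lemma entire_mero_nz: "f analytic_on UNIV \<Longrightarrow> f \<noteq> (\<lambda>_. 0) \<Longrightarrow> mero_nz f"
  using analytic_on_imp_nicely_meromorphic_on by (auto simp: mero_nz_def)

lemma entire_pole_count_eq_0:
  assumes "f analytic_on UNIV"
  shows "pole_count t f = 0"
proof -
  have "\<not> is_pole f z" for z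
    using assms analytic_at_imp_no_pole analytic_on_subset by blast
  then show ?thesis by (simp add: pole_count_def)
qed

lemma const_mem_mero_less_1: "(\<lambda>_. c) \<in> mero_less_1"
proof (cases "c = 0")
  case False
  then have "mero_nz (\<lambda>_. c)" by (auto intro!: entire_mero_nz simp: fun_eq_iff)
  then show ?thesis
    by (simp add: mero_less_1_iff entire_pole_count_eq_0 nev_proximity_eq const_smallo_id)
qed (simp add: zero_mem_mero_less_1)

lemma ident_mem_mero_less_1: "(\<lambda>z. z) \<in> mero_less_1"
proof -
  have nz: "mero_nz (\<lambda>z. z)" by (auto intro!: entire_mero_nz simp: fun_eq_iff)
  have "eventually (\<lambda>r. \<bar>nev_proximity r (\<lambda>z. z)\<bar> \<le> ln r) at_top"
    using eventually_ge_at_top[of 1]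
  proof eventually_elim
    case (elim r)
    have "circle_mean 0 r (\<lambda>z. max 0 (ln (cmod z))) = circle_mean 0 r (\<lambda>_. ln r)"
      by (rule circle_mean_cong[where A = "{}"]) (use elim in auto)
    then show ?case using elim by (simp add: nev_proximity_eq)
  qed
  from smallo_id_dominated[OF this ln_smallo_id] show ?thesis
    by (simp add: mero_less_1_iff[OF nz] entire_pole_count_eq_0 const_smallo_id)
qed

section \<open>$M_{<1}$ is closed under the shift\<close>

lemma nicely_meromorphic_shift:
  assumes "g nicely_meromorphic_on UNIV"
  shows "shift g nicely_meromorphic_on UNIV"
proof -
  have m: "g meromorphic_on UNIV" using assms by (rule nice_imp_mero)
  have "(\<lambda>z. g (z + 1)) meromorphic_on UNIV"
    by (rule meromorphic_on_compose[OF m]) (auto intro!: analytic_intros)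
  moreover have "(is_pole (\<lambda>z. g (z + 1)) z \<and> g (z + 1) = 0) \<or> (\<lambda>z. g (z + 1)) \<midarrow>z\<rightarrow> g (z + 1)" for z
  proof -
    have at: "at (z + 1) = filtermap (\<lambda>w. w + 1) (at z)" using filtermap_at_shift[of "-1" z] by simp
    have "(is_pole g (z + 1) \<and> g (z + 1) = 0) \<or> g \<midarrow>(z + 1)\<rightarrow> g (z + 1)"
      using assms by (auto simp: nicely_meromorphic_on_def)
    then show ?thesis unfolding is_pole_def at filterlim_filtermap .
  qed
  ultimately show ?thesis by (simp add: nicely_meromorphic_on_def shift_def)
qed

lemma mero_nz_shift: "mero_nz g \<Longrightarrow> mero_nz (shift g)"
proof -
  assume g: "mero_nz g"
  then obtain z where "g z \<noteq> 0" by (auto simp: mero_nz_def fun_eq_iff)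
  then have "shift g (z - 1) \<noteq> 0" by (simp add: shift_def)
  then show ?thesis using nicely_meromorphic_shift[OF mero_nzD(1)[OF g]] by (auto simp: mero_nz_def)
qed

lemma zorder_shift_1: "zorder (shift g) z = zorder g (z + 1)"
  using zorder_shift[of "shift g" z] zorder_shift[of g "z + 1"] by (simp add: shift_def add_ac)

lemma pole_count_shift_le:
  assumes g: "mero_nz g"
  shows "pole_count t (shift g) \<le> pole_count (t + 1) g"
proof -
  define A where "A = {z \<in> cball 0 t. shift g z = 0}"
  define B where "B = {z \<in> cball 0 (t + 1). g z = 0}"
  have fin: "finite A" "finite B" unfolding A_def B_def using g mero_nz_shift[OF g] mero_nz_finite_zeros by blast+
  have sub: "(\<lambda>z. z + 1) ` A \<subseteq> B"
  proof
    fix w assume "w \<in> (\<lambda>z. z + 1) ` A"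
    then obtain z where z: "z \<in> A" "w = z + 1" by auto
    have "cmod (z + 1) \<le> cmod z + cmod 1" by (rule norm_triangle_ineq)
    with z show "w \<in> B" by (auto simp: A_def B_def shift_def)
  qed
  have "pole_count t (shift g) = (\<Sum>a\<in>A. nat (- zorder g (a + 1)))"
    by (subst pole_count_eq_sum[OF mero_nz_shift[OF g] fin(1)]) (auto simp: A_def zorder_shift_1)
  also have "\<dots> = (\<Sum>a\<in>(\<lambda>z. z + 1) ` A. nat (- zorder g a))"
    by (subst sum.reindex) (auto simp: inj_on_def)
  also have "\<dots> \<le> (\<Sum>a\<in>B. nat (- zorder g a))"
    by (intro sum_mono2 fin sub) auto
  also have "\<dots> = pole_count (t + 1) g"
    by (subst pole_count_eq_sum[OF g fin(2)]) (auto simp: B_def)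
  finally show ?thesis .
qed

text \<open>
  The logarithm is at most \<open>log 2\<close> on the circle, and its mean is at least \<open>log (r / R)\<close>. A bound from
  above together with the mean controls the mean of the absolute value, by \<open>|u| \<le> 2 log 2 - u\<close>.
\<close>
lemma circle_mean_abs_ln_le:
  assumes r: "0 < r" "r \<le> R" and bd: "\<And>z. cmod (z - c) = r \<Longrightarrow> cmod (z - a) \<le> 2 * R"
  shows "circle_integrable c r (\<lambda>z. \<bar>ln (cmod (z - a) / R)\<bar>)"
    and "circle_mean c r (\<lambda>z. \<bar>ln (cmod (z - a) / R)\<bar>) \<le> 2 * ln 2 + ln (R / r)"
proof -
  have R: "R > 0" using r by simp
  define u where "u = (\<lambda>z. ln (cmod (z - a)) + (- ln R))"
  have u: "circle_integrable c r u" unfolding u_def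
    by (intro circle_integrable_add circle_integrable_const ln_norm_circle(1) r)
  have mu: "circle_mean c r u = ln (max r (cmod (a - c))) + (- ln R)" unfolding u_def
    by (simp only: circle_mean_add ln_norm_circle[OF r(1)] circle_integrable_const circle_mean_const)
  have eq: "u z = ln (cmod (z - a) / R)" if "z \<notin> {a}" for z
    using that R by (simp add: u_def ln_div)
  show int: "circle_integrable c r (\<lambda>z. \<bar>ln (cmod (z - a) / R)\<bar>)"
    by (rule circle_integrable_cong[OF _ _ _ circle_integrable_abs[OF u], where A = "{a}"]) (use r eq in auto)
  have "circle_mean c r (\<lambda>z. \<bar>ln (cmod (z - a) / R)\<bar>) \<le> circle_mean c r (\<lambda>z. 2 * ln 2 + (-1) * u z)"
  proof (rule circle_mean_mono_finite[OF int _ _ finite.insertI[OF finite.emptyI, of a]])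
    fix z assume z: "cmod (z - c) = \<bar>r\<bar>" "z \<notin> {a}"
    then have "u z \<le> ln 2" using bd[of z] r R z(2)
      by (subst eq[OF z(2)], intro ln_mono) (auto simp: field_simps)
    moreover have "(0::real) \<le> ln 2" by simp
    ultimately show "\<bar>ln (cmod (z - a) / R)\<bar> \<le> 2 * ln 2 + (-1) * u z"
      unfolding eq[OF z(2), symmetric] by linarith
  next
    show "circle_integrable c r (\<lambda>z. 2 * ln 2 + (-1) * u z)"
      by (intro circle_integrable_add circle_integrable_const circle_integrable_cmult u)
  qed (use r in auto)
  also have "\<dots> = 2 * ln 2 + (-1) * circle_mean c r u"
    by (simp only: circle_mean_add[OF circle_integrable_const circle_integrable_cmult[OF u]] circle_mean_cmult circle_mean_const)
  also have "\<dots> \<le> 2 * ln 2 + ln (R / r)"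
  proof -
    have "ln r \<le> ln (max r (cmod (a - c)))" using r by (intro ln_mono) auto
    then show ?thesis using r R by (simp add: mu ln_div)
  qed
  finally show "circle_mean c r (\<lambda>z. \<bar>ln (cmod (z - a) / R)\<bar>) \<le> 2 * ln 2 + ln (R / r)" .
qed

text \<open>
  For \<open>|a| \<le> R\<close>, scaling a factor by \<open>R\<close> makes its logarithm have mean 0 on the circle of radius \<open>R\<close>
  about the origin. The price is an additive constant in the exponent, which has no effect on differences \<open>L z - L 0\<close>.
\<close>
lemma ln_norm_exp_powi_prod:
  fixes e :: "complex \<Rightarrow> int"
  assumes "R > 0" "finite A" "z \<notin> A"
  shows "ln (cmod (exp l * (\<Prod>a\<in>A. (z - a) powi e a))) =
    Re (l + of_real ((\<Sum>a\<in>A. of_int (e a)) * ln R)) + (\<Sum>a\<in>A. of_int (e a) * ln (cmod (z - a) / R))"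
proof -
  have "(\<Sum>a\<in>A. of_int (e a) * ln (cmod (z - a))) =
      (\<Sum>a\<in>A. of_int (e a)) * ln R + (\<Sum>a\<in>A. of_int (e a) * ln (cmod (z - a) / R))"
    unfolding sum_distrib_right sum.distrib[symmetric]
  proof (rule sum.cong[OF refl])
    fix a assume "a \<in> A"
    then have "cmod (z - a) > 0" using assms(3) by auto
    then show "of_int (e a) * ln (cmod (z - a)) = of_int (e a) * ln R + of_int (e a) * ln (cmod (z - a) / R)"
      using assms(1) by (simp add: ln_div algebra_simps)
  qed
  then show ?thesis
    using ln_norm_powi_prod[of "exp l" A z e] assms by (simp add: norm_exp_eq_Re)
qed

text \<open>
  On the circle, \<open>Re L\<close> is \<open>log |g|\<close> minus the contribution of zeros and poles, and the mean of
  \<open>|log |g||\<close> is \<open>m(R,g) + m(R,1/g)\<close>. If \<open>g\<close> is in $M_{<1}$ and \<open>A\<close> consists of its zeros and poles in the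
  disc, then the right-hand side is \<open>o(R)\<close>.
\<close>
lemma mean_abs_Re_log_le:
  assumes g: "mero_nz g" and R: "R > 0" and A: "finite A" "A \<subseteq> cball 0 R"
    and L: "L holomorphic_on S" "open S" "cball 0 R \<subseteq> S"
    and eq: "\<And>z. z \<in> cball 0 R - A \<Longrightarrow>
      ln (cmod (g z)) = Re (L z) + (\<Sum>a\<in>A. of_int (zorder g a) * ln (cmod (z - a) / R))"
  shows "circle_mean 0 R (\<lambda>z. \<bar>Re (L z)\<bar>) \<le>
    nev_proximity R g + nev_proximity R (\<lambda>z. inverse (g z)) + 2 * ln 2 * (\<Sum>a\<in>A. \<bar>of_int (zorder g a)\<bar>)"
proof -
  have ig: "circle_integrable 0 R (\<lambda>z. max 0 (ln (cmod (g z))))"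
    "circle_integrable 0 R (\<lambda>z. max 0 (ln (cmod (inverse (g z)))))"
    by (intro circle_integrable_proximity mero_nzD mero_nz_inverse g R)+
  have ia: "circle_integrable 0 R (\<lambda>z. \<bar>ln (cmod (z - a) / R)\<bar>)"
    "circle_mean 0 R (\<lambda>z. \<bar>ln (cmod (z - a) / R)\<bar>) \<le> 2 * ln 2" if "a \<in> A" for a
  proof -
    have "cmod (z - a) \<le> 2 * R" if "cmod (z - 0) = R" for z
      using norm_triangle_ineq4[of z a] that \<open>a \<in> A\<close> A(2) by auto
    from circle_mean_abs_ln_le[where c = 0, OF R order.refl this]
    show "circle_integrable 0 R (\<lambda>z. \<bar>ln (cmod (z - a) / R)\<bar>)"
      "circle_mean 0 R (\<lambda>z. \<bar>ln (cmod (z - a) / R)\<bar>) \<le> 2 * ln 2" using R by auto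
  qed
  have "circle_mean 0 R (\<lambda>z. \<bar>Re (L z)\<bar>) \<le> circle_mean 0 R (\<lambda>z.
      (max 0 (ln (cmod (g z))) + max 0 (ln (cmod (inverse (g z))))) +
      (\<Sum>a\<in>A. \<bar>of_int (zorder g a)\<bar> * \<bar>ln (cmod (z - a) / R)\<bar>))"
  proof (rule circle_mean_mono_finite[OF _ _ _ A(1)])
    show "circle_integrable 0 R (\<lambda>z. \<bar>Re (L z)\<bar>)"
      by (intro circle_integrable_abs circle_mean_Re_holomorphic(1)[OF L] R)
    show "circle_integrable 0 R (\<lambda>z.
      (max 0 (ln (cmod (g z))) + max 0 (ln (cmod (inverse (g z))))) +
      (\<Sum>a\<in>A. \<bar>of_int (zorder g a)\<bar> * \<bar>ln (cmod (z - a) / R)\<bar>))"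
      by (intro circle_integrable_add ig circle_integrable_sum circle_integrable_cmult ia)
    fix z assume z: "cmod (z - 0) = \<bar>R\<bar>" "z \<notin> A"
    have "\<bar>Re (L z)\<bar> = \<bar>ln (cmod (g z)) - (\<Sum>a\<in>A. of_int (zorder g a) * ln (cmod (z - a) / R))\<bar>"
      using eq[of z] z R by simp
    also have "\<dots> \<le> \<bar>ln (cmod (g z))\<bar> + \<bar>\<Sum>a\<in>A. of_int (zorder g a) * ln (cmod (z - a) / R)\<bar>"
      by (rule abs_triangle_ineq4)
    also have "\<bar>\<Sum>a\<in>A. of_int (zorder g a) * ln (cmod (z - a) / R)\<bar> \<le> (\<Sum>a\<in>A. \<bar>of_int (zorder g a)\<bar> * \<bar>ln (cmod (z - a) / R)\<bar>)"
      unfolding abs_mult[symmetric] by (rule sum_abs)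
    also have "\<bar>ln (cmod (g z))\<bar> = max 0 (ln (cmod (g z))) + max 0 (ln (cmod (inverse (g z))))"
      by (simp add: norm_inverse ln_inverse max_def)
    finally show "\<bar>Re (L z)\<bar> \<le> (max 0 (ln (cmod (g z))) + max 0 (ln (cmod (inverse (g z))))) +
      (\<Sum>a\<in>A. \<bar>of_int (zorder g a)\<bar> * \<bar>ln (cmod (z - a) / R)\<bar>)" by simp
  qed (use R in auto)
  also have "\<dots> = nev_proximity R g + nev_proximity R (\<lambda>z. inverse (g z)) +
      (\<Sum>a\<in>A. \<bar>of_int (zorder g a)\<bar> * circle_mean 0 R (\<lambda>z. \<bar>ln (cmod (z - a) / R)\<bar>))"
    unfolding nev_proximity_eq
    by (simp only: circle_mean_add circle_mean_sum circle_mean_cmult ig ia(1)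
        circle_integrable_add circle_integrable_sum circle_integrable_cmult)
  also have "\<dots> \<le> nev_proximity R g + nev_proximity R (\<lambda>z. inverse (g z)) +
      (\<Sum>a\<in>A. \<bar>of_int (zorder g a)\<bar> * (2 * ln 2))"
    by (intro add_left_mono sum_mono mult_left_mono ia(2)) auto
  also have "(\<Sum>a\<in>A. \<bar>of_int (zorder g a)\<bar> * (2 * ln 2)) = 2 * ln 2 * (\<Sum>a\<in>A. \<bar>real_of_int (zorder g a)\<bar>)"
    by (simp only: sum_distrib_right[symmetric] mult.commute)
  finally show ?thesis .
qed

text \<open>
  The circle of radius \<open>r\<close> about 1 lies in the disc of radius \<open>2 r\<close>, half of \<open>R = 4 r\<close>. There the
  Schwarz formula bounds \<open>|Re L|\<close> by three times its mean over the circle of radius \<open>R\<close>, one of them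
  for \<open>Re (L 0)\<close>. The remaining terms \<open>log (|z - a| / R)\<close> have mean modulus at most \<open>4 log 2\<close>.
\<close>
lemma nev_proximity_shift_le:
  assumes g: "mero_nz g" and r: "r \<ge> 1"
  shows "nev_proximity r (shift g) \<le>
    3 * (nev_proximity (4 * r) g + nev_proximity (4 * r) (\<lambda>z. inverse (g z))) +
    10 * ln 2 * (real (pole_count (4 * r) g) + real (pole_count (4 * r) (\<lambda>z. inverse (g z))))"
proof -
  define R where "R = 4 * r"
  have R: "R > 0" "r > 0" using r by (auto simp: R_def)
  define A where "A = {z \<in> cball 0 R. g z = 0}"
  have fin: "finite A" unfolding A_def by (rule mero_nz_finite_zeros[OF g])
  have A: "A \<subseteq> cball 0 R" by (auto simp: A_def)
  define e where "e = (\<lambda>a. real_of_int (zorder g a))"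
  define E where "E = (\<Sum>a\<in>A. \<bar>e a\<bar>)"
  have E: "E = real (pole_count R g) + real (pole_count R (\<lambda>z. inverse (g z)))"
  proof -
    have "real (pole_count R g) + real (pole_count R (\<lambda>z. inverse (g z))) =
        (\<Sum>a\<in>A. real (nat (- zorder g a)) + real (nat (zorder g a)))"
      by (subst (1 2) pole_count_eq_sum[OF _ fin A])
         (use g in \<open>auto simp: A_def mero_nz_inverse mero_nz_zorder_inverse sum.distrib\<close>)
    also have "\<dots> = E" unfolding E_def e_def by (intro sum.cong refl) auto
    finally show ?thesis ..
  qed
  obtain h where h: "h analytic_on cball 0 R" "\<And>z. z \<in> cball 0 R \<Longrightarrow> h z \<noteq> 0"
    "\<And>z. z \<in> cball 0 R - A \<Longrightarrow> g z = h z * (\<Prod>a\<in>A. (z - a) powi zorder g a)"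
    using mero_factorization[OF g fin A_def] by blast
  obtain \<rho> L0 where L0: "\<rho> > R" "L0 holomorphic_on ball 0 \<rho>" "\<And>z. z \<in> ball 0 \<rho> \<Longrightarrow> h z = exp (L0 z)"
    using analytic_log_cball[OF h(1,2) R(1)] by blast
  define L where "L = (\<lambda>z. L0 z + of_real ((\<Sum>a\<in>A. of_int (zorder g a)) * ln R))"
  have L: "L holomorphic_on ball 0 \<rho>" unfolding L_def by (intro holomorphic_intros L0)
  have sub: "cball 0 R \<subseteq> ball 0 \<rho>" using L0(1) by auto
  have eq: "ln (cmod (g z)) = Re (L z) + (\<Sum>a\<in>A. of_int (zorder g a) * ln (cmod (z - a) / R))"
    if z: "z \<in> cball 0 R - A" for z
    using h(3)[OF z] L0(3)[of z] ln_norm_exp_powi_prod[OF R(1) fin, of z "L0 z" "zorder g"] z L0(1)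
    by (simp add: L_def)
  define M where "M = circle_mean 0 R (\<lambda>z. \<bar>Re (L z)\<bar>)"
  have M: "M \<le> nev_proximity R g + nev_proximity R (\<lambda>z. inverse (g z)) + 2 * ln 2 * E"
    using mean_abs_Re_log_le[OF g R(1) fin A L open_ball sub eq] by (simp add: M_def E_def e_def)
  have "\<bar>Re (L 0)\<bar> \<le> M"
  proof -
    note Re0 = circle_mean_Re_holomorphic[OF L open_ball sub R(1)]
    have "Re (L 0) \<le> M" unfolding M_def Re0(2)[symmetric]
      by (intro circle_mean_mono Re0 circle_integrable_abs) auto
    moreover have "(-1) * Re (L 0) \<le> M" unfolding M_def Re0(2)[symmetric] circle_mean_cmult[symmetric]
      by (intro circle_mean_mono Re0 circle_integrable_abs circle_integrable_cmult) auto
    ultimately show ?thesis by linarith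
  qed
  moreover have "\<bar>Re (L z) - Re (L 0)\<bar> \<le> 2 * M" if "cmod z \<le> R / 2" for z
  proof -
    have "\<bar>Re (L z - L 0)\<bar> \<le> 2 * cmod z / (R - cmod z) * M"
      unfolding M_def
      by (rule order.trans[OF abs_Re_le_cmod Schwarz_integral_bound[OF L open_ball sub]]) (use that R in auto)
    also have "\<dots> \<le> 2 * M"
    proof (rule mult_right_mono)
      show "2 * cmod z / (R - cmod z) \<le> 2" using that R by (simp add: field_simps)
      show "0 \<le> M" unfolding M_def by (rule circle_mean_nonneg) simp
    qed
    finally show ?thesis by simp
  qed
  ultimately have ReL: "\<bar>Re (L z)\<bar> \<le> 3 * M" if "cmod z \<le> R / 2" for z using that by (smt (verit))
  have sphere: "cmod z \<le> R / 2" if "cmod (z - 1) = \<bar>r\<bar>" for z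
    using norm_triangle_ineq[of "z - 1" 1] that r by (simp add: R_def)
  have ia: "circle_integrable 1 r (\<lambda>z. \<bar>ln (cmod (z - a) / R)\<bar>)"
    "circle_mean 1 r (\<lambda>z. \<bar>ln (cmod (z - a) / R)\<bar>) \<le> 4 * ln 2" if "a \<in> A" for a
  proof -
    have "cmod (z - a) \<le> 2 * R" if "cmod (z - 1) = r" for z
      using norm_triangle_ineq4[of z a] sphere[of z] that \<open>a \<in> A\<close> A R by auto
    from circle_mean_abs_ln_le[where c = 1, OF R(2) _ this]
    have "circle_integrable 1 r (\<lambda>z. \<bar>ln (cmod (z - a) / R)\<bar>)"
      "circle_mean 1 r (\<lambda>z. \<bar>ln (cmod (z - a) / R)\<bar>) \<le> 2 * ln 2 + ln (R / r)" using R by (auto simp: R_def)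
    moreover have "ln (R / r) = 2 * ln 2"
      using R ln_realpow[of 2 2] by (simp add: R_def)
    ultimately show "circle_integrable 1 r (\<lambda>z. \<bar>ln (cmod (z - a) / R)\<bar>)"
      "circle_mean 1 r (\<lambda>z. \<bar>ln (cmod (z - a) / R)\<bar>) \<le> 4 * ln 2" by auto
  qed
  have "nev_proximity r (shift g) = circle_mean 1 r (\<lambda>z. max 0 (ln (cmod (g z))))"
    by (simp add: nev_proximity_eq circle_mean_def shift_def add.commute)
  also have "\<dots> \<le> circle_mean 1 r (\<lambda>z. 3 * M + (\<Sum>a\<in>A. \<bar>e a\<bar> * \<bar>ln (cmod (z - a) / R)\<bar>))"
  proof (rule circle_mean_mono_finite[OF _ _ _ fin])
    show "circle_integrable 1 r (\<lambda>z. max 0 (ln (cmod (g z))))"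
      by (intro circle_integrable_proximity mero_nzD g R)
    show "circle_integrable 1 r (\<lambda>z. 3 * M + (\<Sum>a\<in>A. \<bar>e a\<bar> * \<bar>ln (cmod (z - a) / R)\<bar>))"
      by (intro circle_integrable_add circle_integrable_const circle_integrable_sum circle_integrable_cmult ia)
    fix z assume z: "cmod (z - 1) = \<bar>r\<bar>" "z \<notin> A"
    have zR: "cmod z \<le> R / 2" by (rule sphere[OF z(1)])
    then have "ln (cmod (g z)) = Re (L z) + (\<Sum>a\<in>A. e a * ln (cmod (z - a) / R))"
      using eq[of z] z(2) R by (simp add: e_def)
    also have "\<dots> \<le> 3 * M + (\<Sum>a\<in>A. \<bar>e a\<bar> * \<bar>ln (cmod (z - a) / R)\<bar>)"
      using ReL[OF zR] by (intro add_mono sum_mono) (auto simp: abs_mult[symmetric])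
    finally have "ln (cmod (g z)) \<le> 3 * M + (\<Sum>a\<in>A. \<bar>e a\<bar> * \<bar>ln (cmod (z - a) / R)\<bar>)" .
    moreover have "0 \<le> 3 * M + (\<Sum>a\<in>A. \<bar>e a\<bar> * \<bar>ln (cmod (z - a) / R)\<bar>)"
      using ReL[OF zR] by (intro add_nonneg_nonneg sum_nonneg) auto
    ultimately show "max 0 (ln (cmod (g z))) \<le> 3 * M + (\<Sum>a\<in>A. \<bar>e a\<bar> * \<bar>ln (cmod (z - a) / R)\<bar>)" by simp
  qed (use R in auto)
  also have "\<dots> = 3 * M + (\<Sum>a\<in>A. \<bar>e a\<bar> * circle_mean 1 r (\<lambda>z. \<bar>ln (cmod (z - a) / R)\<bar>))"
    by (simp only: circle_mean_add circle_mean_sum circle_mean_cmult circle_mean_const ia(1)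
        circle_integrable_const circle_integrable_sum circle_integrable_cmult)
  also have "\<dots> \<le> 3 * M + (\<Sum>a\<in>A. \<bar>e a\<bar> * (4 * ln 2))"
    by (intro add_left_mono sum_mono mult_left_mono ia(2)) auto
  also have "\<dots> = 3 * M + 4 * ln 2 * E" by (simp add: E_def sum_distrib_right[symmetric] mult_ac)
  also have "\<dots> \<le> 3 * (nev_proximity R g + nev_proximity R (\<lambda>z. inverse (g z)) + 2 * ln 2 * E) + 4 * ln 2 * E"
    using mult_left_mono[OF M, of 3] by (simp add: mult_ac)
  also have "\<dots> = 3 * (nev_proximity R g + nev_proximity R (\<lambda>z. inverse (g z))) + 10 * ln 2 * E"
    by (simp add: algebra_simps)
  finally show ?thesis by (simp only: E R_def)
qed

lemma mero_less_1_shift: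
  assumes "g \<in> mero_less_1"
  shows "shift g \<in> mero_less_1"
proof (cases "g = (\<lambda>_. 0)")
  case True
  then show ?thesis by (simp add: shift_def zero_mem_mero_less_1)
next
  case False
  with assms have g: "mero_nz g" by (rule mero_less_1_nz)
  have g': "mero_nz (\<lambda>z. inverse (g z))" "(\<lambda>z. inverse (g z)) \<in> mero_less_1"
    by (intro mero_nz_inverse mero_less_1_inverse g assms)+
  have m: "(\<lambda>r. nev_proximity r g) \<in> o(\<lambda>r. r)" "(\<lambda>r. real (pole_count r g)) \<in> o(\<lambda>r. r)"
    "(\<lambda>r. nev_proximity r (\<lambda>z. inverse (g z))) \<in> o(\<lambda>r. r)"
    "(\<lambda>r. real (pole_count r (\<lambda>z. inverse (g z)))) \<in> o(\<lambda>r. r)"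
    using assms g' g by (simp_all add: mero_less_1_iff)
  note m4 = m[THEN smallo_id_scale[where k = 4 and m = 0], simplified]
  have "(\<lambda>r. nev_proximity r (shift g)) \<in> o(\<lambda>r. r)"
  proof (rule smallo_id_dominated)
    show "\<forall>\<^sub>F r in at_top. \<bar>nev_proximity r (shift g)\<bar> \<le>
      3 * (nev_proximity (4 * r) g + nev_proximity (4 * r) (\<lambda>z. inverse (g z))) +
      10 * ln 2 * (real (pole_count (4 * r) g) + real (pole_count (4 * r) (\<lambda>z. inverse (g z))))"
      using eventually_ge_at_top[of 1]
      by eventually_elim (use nev_proximity_shift_le[OF g] nev_proximity_nonneg in simp)
  qed (intro sum_in_smallo smallo_id_cmult m4)
  moreover have "(\<lambda>r. real (pole_count r (shift g))) \<in> o(\<lambda>r. r)"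
  proof (rule smallo_id_dominated[OF always_eventually])
    show "(\<lambda>r. real (pole_count (1 * r + 1) g)) \<in> o(\<lambda>r. r)"
      by (rule smallo_id_scale[OF m(2)]) simp
  qed (use pole_count_shift_le[OF g] in simp)
  ultimately show ?thesis by (simp add: mero_less_1_iff[OF mero_nz_shift[OF g]])
qed

section \<open>Field operations in terms of representatives\<close>

lemma mero_simps:
  "carrier mero = {f. f nicely_meromorphic_on UNIV}"
  "f \<otimes>\<^bsub>mero\<^esub> g = remove_sings (\<lambda>z. f z * g z)"
  "f \<oplus>\<^bsub>mero\<^esub> g = remove_sings (\<lambda>z. f z + g z)"
  "\<one>\<^bsub>mero\<^esub> = (\<lambda>_. 1)" "\<zero>\<^bsub>mero\<^esub> = (\<lambda>_. 0)"
  by (simp_all add: mero_def)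

interpretation M: domain mero using field_mero by (rule field.axioms(1))

lemma mero_uminus:
  assumes "f \<in> carrier mero"
  shows "\<ominus>\<^bsub>mero\<^esub> f = (\<lambda>z. - f z)"
proof (rule M.minus_equality)
  show "(\<lambda>z. - f z) \<in> carrier mero"
    using assms by (simp add: mero_simps nicely_meromorphic_on_uminus)
qed (use assms in \<open>simp_all add: mero_simps remove_sings_const\<close>)

lemma mero_inv:
  assumes "f \<in> carrier mero" "f \<noteq> \<zero>\<^bsub>mero\<^esub>"
  shows "inv\<^bsub>mero\<^esub> f = (\<lambda>z. inverse (f z))"
proof (rule M.comm_inv_char)
  show "f \<in> carrier mero" "(\<lambda>z. inverse (f z)) \<in> carrier mero"
    using assms by (auto simp: mero_simps intro: nicely_meromorphic_on_inverse)
  show "f \<otimes>\<^bsub>mero\<^esub> (\<lambda>z. inverse (f z)) = \<one>\<^bsub>mero\<^esub>"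
    using nicely_mero_inverse[of f] assms by (simp add: mero_simps mult.commute)
qed

lemma mero_carrier_iff_nz: "f \<in> carrier mero \<Longrightarrow> f \<noteq> \<zero>\<^bsub>mero\<^esub> \<longleftrightarrow> mero_nz f"
  by (auto simp: mero_simps mero_nz_def)

lemma mero_less_1_carrier: "f \<in> mero_less_1 \<Longrightarrow> f \<in> carrier mero"
  by (simp add: mero_less_1_def)

lemma mero_less_1_uminus: "f \<in> mero_less_1 \<Longrightarrow> (\<lambda>z. - f z) \<in> mero_less_1"
  using mero_less_1_mult[OF const_mem_mero_less_1[of "-1"], of f]
    nicely_mero_remove_sings[OF nicely_meromorphic_on_uminus[of f UNIV]]
  by (simp add: mero_less_1_def mero_simps)

lemma mero_less_1_inverse_total: "f \<in> mero_less_1 \<Longrightarrow> (\<lambda>z. inverse (f z)) \<in> mero_less_1"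
  using mero_less_1_inverse[of f] mero_less_1_nz[of f] zero_mem_mero_less_1 by (cases "f = (\<lambda>_. 0)") auto

section \<open>Zeros along arithmetic progressions\<close>

text \<open>
  Every point with \<open>g z = 0\<close> is a pole of \<open>g\<close> or of \<open>1 / g\<close>, and both have \<open>o(r)\<close> poles in the disc of radius
  \<open>r\<close>, whereas the progression has about \<open>r\<close> points there. As stated it excludes progressions of poles as
  well, and mixtures of both.
\<close>
lemma mero_less_1_no_zero_progression:
  assumes g: "mero_nz g" "g \<in> mero_less_1" and d: "cmod d = 1"
  shows "\<exists>n::nat. g (z0 + of_nat n * d) \<noteq> 0"
proof (rule ccontr)
  assume "\<not> ?thesis"
  then have zero: "g (z0 + of_nat n * d) = 0" for n :: nat by auto
  have d0: "d \<noteq> 0" using d by auto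
  define h where "h = (\<lambda>z. inverse (g z))"
  have h: "mero_nz h" "h \<in> mero_less_1" unfolding h_def by (intro mero_nz_inverse mero_less_1_inverse g)+
  have count: "r - cmod z0 \<le> real (pole_count r g) + real (pole_count r h)" if r: "r \<ge> cmod z0" for r
  proof -
    define A where "A = {z \<in> cball 0 r. g z = 0}"
    have fin: "finite A" unfolding A_def by (rule mero_nz_finite_zeros[OF g(1)])
    define N where "N = nat \<lfloor>r - cmod z0\<rfloor>"
    have sub: "(\<lambda>n. z0 + of_nat n * d) ` {..N} \<subseteq> A"
    proof
      fix w assume "w \<in> (\<lambda>n. z0 + of_nat n * d) ` {..N}"
      then obtain n where n: "n \<le> N" "w = z0 + of_nat n * d" by auto
      have "cmod w \<le> cmod z0 + cmod (of_nat n * d)" unfolding n(2) by (rule norm_triangle_ineq)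
      also have "\<dots> = cmod z0 + real n" using d by (simp add: norm_mult)
      also have "\<dots> \<le> r" using n(1) r unfolding N_def by linarith
      finally show "w \<in> A" using zero n(2) by (simp add: A_def)
    qed
    have inj: "inj_on (\<lambda>n. z0 + of_nat n * d) {..N}"
      using d0 by (auto simp: inj_on_def)
    have "r - cmod z0 \<le> real (N + 1)" unfolding N_def by linarith
    also have "N + 1 = card ((\<lambda>n. z0 + of_nat n * d) ` {..N})"
      using card_image[OF inj] by simp
    also have "\<dots> \<le> card A" by (rule card_mono[OF fin sub])
    also have "card A = (\<Sum>a\<in>A. 1)" by simp
    also have "\<dots> \<le> (\<Sum>a\<in>A. nat (- zorder g a) + nat (- zorder h a))"
    proof (rule sum_mono)
      fix a assume "a \<in> A"
      then have "zorder g a \<noteq> 0" using mero_nz_zorder_eq_0_iff[OF g(1)] by (simp add: A_def)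
      then show "1 \<le> nat (- zorder g a) + nat (- zorder h a)"
        unfolding h_def mero_nz_zorder_inverse[OF g(1)] by auto
    qed
    also have "\<dots> = pole_count r g + pole_count r h"
      by (subst (1 2) pole_count_eq_sum[OF _ fin]) (use g h in \<open>auto simp: A_def h_def sum.distrib\<close>)
    finally show ?thesis by simp
  qed
  have "(\<lambda>r. real (pole_count r g) + real (pole_count r h)) \<in> o(\<lambda>r. r)"
    using g h by (intro sum_in_smallo) (simp_all add: mero_less_1_iff)
  from landau_o.smallD[OF this, of "1/2"]
  have "eventually (\<lambda>r. norm (real (pole_count r g) + real (pole_count r h)) \<le> 1 / 2 * norm r) at_top" by simp
  then have "eventually (\<lambda>r::real. False) at_top"
    using eventually_gt_at_top[of "2 * cmod z0"]
  proof eventually_elim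
    case (elim r)
    have "cmod z0 \<ge> 0" by simp
    with elim have "r > 0" "r \<ge> cmod z0" by linarith+
    with elim count[of r] show ?case by simp
  qed
  then show False by simp
qed

lemma mero_less_1_eq_zeroI:
  assumes "g \<in> mero_less_1" "\<And>n::nat. g (z0 + of_nat n) = 0"
  shows "g = (\<lambda>_. 0)"
  using mero_less_1_no_zero_progression[OF mero_less_1_nz[OF assms(1)] assms(1), of 1 z0] assms(2) by auto

section \<open>Specialization of periodic coefficients\<close>

lemma countable_orbits:
  assumes "countable (S :: complex set)"
  shows "countable {z. \<exists>n::nat. z + of_nat n \<in> S}"
proof (rule countable_subset)
  show "{z. \<exists>n::nat. z + of_nat n \<in> S} \<subseteq> (\<Union>n::nat. (\<lambda>s. s - of_nat n) ` S)"
  proof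
    fix z assume "z \<in> {z. \<exists>n::nat. z + of_nat n \<in> S}"
    then obtain n :: nat where "z + of_nat n \<in> S" by auto
    then have "z \<in> (\<lambda>s. s - of_nat n) ` S" by (intro image_eqI[of _ _ "z + of_nat n"]) auto
    then show "z \<in> (\<Union>n::nat. (\<lambda>s. s - of_nat n) ` S)" by blast
  qed
  show "countable (\<Union>n::nat. (\<lambda>s. s - of_nat n) ` S)" using assms by auto
qed

lemma countable_non_analytic_points:
  assumes "f \<in> carrier mero"
  shows "countable {z. \<not> f analytic_on {z}}"
proof (cases "f = \<zero>\<^bsub>mero\<^esub>")
  case True
  then show ?thesis by (simp add: mero_simps)
next
  case False
  then have f: "mero_nz f" using assms mero_carrier_iff_nz by auto
  show ?thesis
    by (rule countable_subset[OF _ mero_nz_countable_zeros[OF f]]) (use mero_nz_analytic_at[OF f] in auto)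
qed

text \<open>
  Analyticity along the progression is part of the definition because the field operations of
  \<^const>\<open>mero\<close> agree with the pointwise ones at points where both arguments are analytic, but at a pole
  they may differ.
\<close>
definition specializes :: "complex \<Rightarrow> (complex \<Rightarrow> complex) \<Rightarrow> (complex \<Rightarrow> complex) \<Rightarrow> bool" where
  "specializes z0 f f' \<longleftrightarrow> (\<forall>n::nat. f analytic_on {z0 + of_nat n} \<and> f' analytic_on {z0 + of_nat n} \<and>
     f' (z0 + of_nat n) = f (z0 + of_nat n))"

lemma specializes_add:
  "specializes z0 f f' \<Longrightarrow> specializes z0 g g' \<Longrightarrow> specializes z0 (f \<oplus>\<^bsub>mero\<^esub> g) (f' \<oplus>\<^bsub>mero\<^esub> g')"
  unfolding specializes_def mero_simps
  by (auto intro!: remove_sings_analytic_on analytic_on_add simp: remove_sings_at_analytic analytic_on_add)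

lemma specializes_mult:
  "specializes z0 f f' \<Longrightarrow> specializes z0 g g' \<Longrightarrow> specializes z0 (f \<otimes>\<^bsub>mero\<^esub> g) (f' \<otimes>\<^bsub>mero\<^esub> g')"
  unfolding specializes_def mero_simps
  by (auto intro!: remove_sings_analytic_on analytic_on_mult simp: remove_sings_at_analytic analytic_on_mult)

text \<open>
  Induction over the generated field. A periodic function is replaced by the constant \<open>h z0\<close>, a function
  in $M_{<1}$ by itself, and the field operations are respected as $M_{<1}$ is a field. The excluded points
  are those whose progression meets a pole of a generator or a zero of an inverted element; countably many,
  as each such set is countable and is translated by natural numbers only.
\<close>
lemma generic_specialization:
  assumes "f \<in> compositum periodic_mero mero_less_1"
  shows "\<exists>E. countable E \<and> (\<forall>z0. z0 \<notin> E \<longrightarrow> (\<exists>f'\<in>mero_less_1. specializes z0 f f'))"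
  using assms unfolding compositum_def
proof (induction rule: generate_field.induct)
  case one
  have "specializes z0 (\<lambda>_. 1) (\<lambda>_. 1)" for z0 by (simp add: specializes_def)
  then show ?case using const_mem_mero_less_1[of 1] unfolding mero_simps
    by (intro exI[of _ "{}"]) auto
next
  case (incl h)
  have hc: "h \<in> carrier mero" using incl by (auto simp: periodic_mero_def mero_less_1_def)
  define E where "E = {z. \<exists>n::nat. z + of_nat n \<in> {z. \<not> h analytic_on {z}}}"
  have E: "countable E" unfolding E_def by (rule countable_orbits[OF countable_non_analytic_points[OF hc]])
  have "\<exists>f'\<in>mero_less_1. specializes z0 h f'" if "z0 \<notin> E" for z0
  proof (cases "h \<in> mero_less_1")
    case True
    then show ?thesis using that by (intro bexI[of _ h]) (auto simp: E_def specializes_def)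
  next
    case False
    then have p: "h (z + 1) = h z" for z using incl by (auto simp: periodic_mero_def shift_def fun_eq_iff)
    have "h (z0 + of_nat n) = h z0" for n :: nat
    proof (induction n)
      case (Suc n)
      then show ?case using p[of "z0 + of_nat n"] by (simp add: add_ac)
    qed simp
    then have "specializes z0 h (\<lambda>_. h z0)" using that by (auto simp: E_def specializes_def)
    then show ?thesis using const_mem_mero_less_1 by blast
  qed
  with E show ?case by blast
next
  case (a_inv h)
  then obtain E where E: "countable E" "\<And>z0. z0 \<notin> E \<Longrightarrow> \<exists>f'\<in>mero_less_1. specializes z0 h f'" by blast
  have hc: "h \<in> carrier mero"
    by (rule field.generate_field_in_carrier[OF field_mero _ a_inv.hyps]) (auto simp: periodic_mero_def mero_less_1_def)
  have "\<exists>f'\<in>mero_less_1. specializes z0 (\<ominus>\<^bsub>mero\<^esub> h) f'" if "z0 \<notin> E" for z0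
  proof -
    from that obtain f' where f': "f' \<in> mero_less_1" "specializes z0 h f'" using E(2) by blast
    then have "specializes z0 (\<ominus>\<^bsub>mero\<^esub> h) (\<lambda>z. - f' z)"
      by (auto simp: mero_uminus[OF hc] specializes_def intro: analytic_on_neg)
    then show ?thesis using mero_less_1_uminus[OF f'(1)] by blast
  qed
  with E show ?case by blast
next
  case (m_inv h)
  then obtain E where E: "countable E" "\<And>z0. z0 \<notin> E \<Longrightarrow> \<exists>f'\<in>mero_less_1. specializes z0 h f'" by blast
  have hc: "h \<in> carrier mero"
    by (rule field.generate_field_in_carrier[OF field_mero _ m_inv.hyps(1)]) (auto simp: periodic_mero_def mero_less_1_def)
  then have hnz: "mero_nz h" using mero_carrier_iff_nz m_inv.hyps(2) by blast
  define E' where "E' = E \<union> {z. \<exists>n::nat. z + of_nat n \<in> {z. h z = 0}}"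
  have E': "countable E'" unfolding E'_def
    using E(1) countable_orbits[OF mero_nz_countable_zeros[OF hnz]] by simp
  have "\<exists>f'\<in>mero_less_1. specializes z0 (inv\<^bsub>mero\<^esub> h) f'" if "z0 \<notin> E'" for z0
  proof -
    have "z0 \<notin> E" using that unfolding E'_def by blast
    then obtain f' where f': "f' \<in> mero_less_1" "specializes z0 h f'" using E(2) by blast
    have "h (z0 + of_nat n) \<noteq> 0" for n :: nat using that by (auto simp: E'_def)
    with f' have "specializes z0 (inv\<^bsub>mero\<^esub> h) (\<lambda>z. inverse (f' z))"
      by (auto simp: mero_inv[OF hc m_inv.hyps(2)] specializes_def intro!: analytic_on_inverse)
    then show ?thesis using mero_less_1_inverse_total[OF f'(1)] by blast
  qed
  with E' show ?case by blast
next
  case (eng_add h1 h2)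
  then obtain E1 E2 where E: "countable E1" "\<And>z0. z0 \<notin> E1 \<Longrightarrow> \<exists>f'\<in>mero_less_1. specializes z0 h1 f'"
    "countable E2" "\<And>z0. z0 \<notin> E2 \<Longrightarrow> \<exists>f'\<in>mero_less_1. specializes z0 h2 f'" by blast
  have "\<exists>f'\<in>mero_less_1. specializes z0 (h1 \<oplus>\<^bsub>mero\<^esub> h2) f'" if "z0 \<notin> E1 \<union> E2" for z0
    using E(2)[of z0] E(4)[of z0] that specializes_add mero_less_1_add unfolding mero_simps(3)
    by (metis (no_types, lifting) UnI1 UnI2)
  with E(1,3) show ?case by (intro exI[of _ "E1 \<union> E2"]) auto
next
  case (eng_mult h1 h2)
  then obtain E1 E2 where E: "countable E1" "\<And>z0. z0 \<notin> E1 \<Longrightarrow> \<exists>f'\<in>mero_less_1. specializes z0 h1 f'"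
    "countable E2" "\<And>z0. z0 \<notin> E2 \<Longrightarrow> \<exists>f'\<in>mero_less_1. specializes z0 h2 f'" by blast
  have "\<exists>f'\<in>mero_less_1. specializes z0 (h1 \<otimes>\<^bsub>mero\<^esub> h2) f'" if "z0 \<notin> E1 \<union> E2" for z0
    using E(2)[of z0] E(4)[of z0] that specializes_mult mero_less_1_mult unfolding mero_simps(2)
    by (metis (no_types, lifting) UnI1 UnI2)
  with E(1,3) show ?case by (intro exI[of _ "E1 \<union> E2"]) auto
qed

lemma entire_remove_sings: "f analytic_on UNIV \<Longrightarrow> remove_sings f = f"
  by (intro nicely_mero_remove_sings analytic_on_imp_nicely_meromorphic_on)

lemma analytic_on_poly_fun: "poly (p :: complex poly) analytic_on A"
proof -
  have "poly p holomorphic_on UNIV"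
    unfolding holomorphic_on_def field_differentiable_def using poly_DERIV by fastforce
  then have "poly p analytic_on UNIV" by (simp add: analytic_on_open)
  then show ?thesis using analytic_on_subset by blast
qed

lemma poly_mem_mero_less_1: "poly p \<in> mero_less_1"
proof (induction p)
  case 0
  have "poly 0 = (\<lambda>z::complex. 0)" by auto
  then show ?case by (simp add: zero_mem_mero_less_1)
next
  case (pCons c p)
  have "remove_sings (\<lambda>z. z * poly p z) = (\<lambda>z. z * poly p z)"
    by (intro entire_remove_sings analytic_intros analytic_on_poly_fun)
  then have "(\<lambda>z. z * poly p z) \<in> mero_less_1"
    using mero_less_1_mult[OF ident_mem_mero_less_1 pCons.IH] by simp
  from mero_less_1_add[OF const_mem_mero_less_1[of c] this]
  have "remove_sings (\<lambda>z. c + z * poly p z) \<in> mero_less_1" .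
  moreover have "remove_sings (\<lambda>z. c + z * poly p z) = poly (pCons c p)"
    by (subst entire_remove_sings) (auto intro!: analytic_intros analytic_on_poly_fun simp: fun_eq_iff)
  ultimately show ?case by (simp only:)
qed

lemma rational_mem_mero_less_1: "a \<in> rational_mero \<Longrightarrow> a \<in> mero_less_1"
  using mero_less_1_mult[OF poly_mem_mero_less_1 mero_less_1_inverse_total[OF poly_mem_mero_less_1]]
  by (auto simp: rational_mero_def divide_inverse)

lemma finite_rational_zeros:
  assumes "a \<in> rational_mero" "a \<noteq> (\<lambda>_. 0)"
  shows "finite {z. a z = 0}"
proof -
  obtain p q where pq: "a = remove_sings (\<lambda>z. poly p z / poly q z)" "q \<noteq> 0"
    using assms by (auto simp: rational_mero_def)
  have "p \<noteq> 0" using pq assms(2) by (auto simp: remove_sings_const)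
  have "{z. a z = 0} \<subseteq> {z. poly p z = 0} \<union> {z. poly q z = 0}"
  proof
    fix z assume z: "z \<in> {z. a z = 0}"
    show "z \<in> {z. poly p z = 0} \<union> {z. poly q z = 0}"
    proof (rule ccontr)
      assume n: "z \<notin> {z. poly p z = 0} \<union> {z. poly q z = 0}"
      then have "(\<lambda>z. poly p z / poly q z) analytic_on {z}" by (intro analytic_intros analytic_on_poly_fun) auto
      then have "a z = poly p z / poly q z" by (simp add: pq)
      with n z show False by auto
    qed
  qed
  then show ?thesis
    using poly_roots_finite[OF \<open>p \<noteq> 0\<close>] poly_roots_finite[OF pq(2)] finite_subset by blast
qed

section \<open>A solution in $M_{<1}$\<close>

lemma shift_remove_sings: "shift (remove_sings u) = remove_sings (shift u)"
proof
  fix z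
  show "shift (remove_sings u) z = remove_sings (shift u) z"
    using remove_sings_shift_0[of u "z + 1"] remove_sings_shift_0[of "shift u" z]
    by (simp add: shift_def add_ac)
qed

lemma shift_mult: "shift (f \<otimes>\<^bsub>mero\<^esub> g) = shift f \<otimes>\<^bsub>mero\<^esub> shift g"
  by (simp add: mero_simps shift_remove_sings) (simp add: shift_def)

text \<open>
  At the points of a generic progression the specialization \<open>b'\<close> has the values of \<open>b\<close>, so the equation
  \<open>shift b = a b\<close> holds for \<open>b'\<close> there. The defect \<open>shift b' - a b'\<close> lies in $M_{<1}$, as that field is
  stable under the shift and contains the rational functions, hence it vanishes identically.
\<close>
lemma exists_solution_less_1:
  assumes a: "a \<in> rational_mero" and b: "b \<in> compositum periodic_mero mero_less_1" "b \<noteq> \<zero>\<^bsub>mero\<^esub>"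
    and eq: "shift b = a \<otimes>\<^bsub>mero\<^esub> b"
  shows "\<exists>b'\<in>mero_less_1. b' \<noteq> \<zero>\<^bsub>mero\<^esub> \<and> shift b' = a \<otimes>\<^bsub>mero\<^esub> b'"
proof -
  have a1: "a \<in> mero_less_1" and ac: "a \<in> carrier mero"
    using rational_mem_mero_less_1[OF a] mero_less_1_carrier by auto
  have bc: "b \<in> carrier mero"
    by (rule field.generate_field_in_carrier[OF field_mero _ b(1)[unfolded compositum_def]])
       (auto simp: periodic_mero_def mero_less_1_def)
  then have bnz: "mero_nz b" using b(2) mero_carrier_iff_nz by blast
  obtain E where E: "countable E" "\<And>z0. z0 \<notin> E \<Longrightarrow> \<exists>f'\<in>mero_less_1. specializes z0 b f'"
    using generic_specialization[OF b(1)] by blast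
  define E' where "E' = E \<union> {z. \<exists>n::nat. z + of_nat n \<in> {z. \<not> a analytic_on {z}}} \<union> {z. b z = 0}"
  have "countable E'" unfolding E'_def
    using E(1) countable_orbits[OF countable_non_analytic_points[OF ac]] mero_nz_countable_zeros[OF bnz] by simp
  then have "E' \<noteq> UNIV" using uncountable_UNIV_complex by auto
  then obtain z0 where z0: "z0 \<notin> E'" by blast
  then obtain b' where b': "b' \<in> mero_less_1" "specializes z0 b b'" using E(2)[of z0] unfolding E'_def by blast
  have b'c: "b' \<in> carrier mero" using b'(1) by (rule mero_less_1_carrier)
  have a_an: "a analytic_on {z0 + of_nat n}" for n :: nat using z0 by (auto simp: E'_def)
  have b_an: "b analytic_on {z0 + of_nat n}" "b' analytic_on {z0 + of_nat n}"
    "b' (z0 + of_nat n) = b (z0 + of_nat n)" for n :: nat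
    using b'(2) by (auto simp: specializes_def)
  have "b' z0 = b z0" using b_an(3)[of 0] by simp
  moreover have "b z0 \<noteq> 0" using z0 by (auto simp: E'_def)
  ultimately have b'0: "b' \<noteq> \<zero>\<^bsub>mero\<^esub>" by (auto simp: mero_simps)
  define G where "G = shift b' \<ominus>\<^bsub>mero\<^esub> (a \<otimes>\<^bsub>mero\<^esub> b')"
  have ab': "a \<otimes>\<^bsub>mero\<^esub> b' \<in> carrier mero" using ac b'c by simp
  have sb': "shift b' \<in> carrier mero" using mero_less_1_carrier[OF mero_less_1_shift[OF b'(1)]] .
  have G_eq: "G = remove_sings (\<lambda>z. shift b' z + - (a \<otimes>\<^bsub>mero\<^esub> b') z)"
    unfolding G_def a_minus_def mero_uminus[OF ab'] by (simp add: mero_simps)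
  have "a \<otimes>\<^bsub>mero\<^esub> b' \<in> mero_less_1" unfolding mero_simps by (intro mero_less_1_mult a1 b')
  then have "G \<in> mero_less_1" unfolding G_eq
    by (intro mero_less_1_add mero_less_1_shift b' mero_less_1_uminus)
  moreover have "G (z0 + of_nat n) = 0" for n :: nat
  proof -
    let ?w = "z0 + of_nat n"
    have w1: "?w + 1 = z0 + of_nat (Suc n)" by (simp add: add_ac)
    have ab: "(a \<otimes>\<^bsub>mero\<^esub> f) ?w = a ?w * f ?w" "(a \<otimes>\<^bsub>mero\<^esub> f) analytic_on {?w}" if "f analytic_on {?w}" for f
      using a_an[of n] that unfolding mero_simps
      by (auto intro!: remove_sings_analytic_on analytic_on_mult remove_sings_at_analytic)
    have s_an: "shift b' analytic_on {?w}"
    proof -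
      have "(b' \<circ> (\<lambda>z. z + 1)) analytic_on {?w}"
        using b_an(2)[of "Suc n"] by (intro analytic_on_compose) (auto intro!: analytic_intros simp: add_ac)
      then show ?thesis by (simp add: shift_def o_def)
    qed
    have "shift b' ?w = b' (z0 + of_nat (Suc n))" unfolding shift_def w1 ..
    also have "\<dots> = b (z0 + of_nat (Suc n))" by (rule b_an(3))
    also have "\<dots> = shift b ?w" unfolding shift_def w1 ..
    also have "\<dots> = a ?w * b' ?w" unfolding eq using ab(1)[OF b_an(1)[of n]] b_an(3)[of n] by simp
    finally have "shift b' ?w = a ?w * b' ?w" .
    then show ?thesis unfolding G_eq
      using ab[OF b_an(2)[of n]] s_an
      by (subst remove_sings_at_analytic) (auto intro!: analytic_on_diff)
  qed
  ultimately have "G = \<zero>\<^bsub>mero\<^esub>" using mero_less_1_eq_zeroI[of G z0] by (simp add: mero_simps)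
  then have "shift b' = a \<otimes>\<^bsub>mero\<^esub> b'" unfolding G_def using sb' ab' by simp
  with b'(1) b'0 show ?thesis by blast
qed

section \<open>Solutions in $M_{<1}$ are rational\<close>

text \<open>
  The orders of \<open>g\<close> at \<open>z\<close> and \<open>z + 1\<close> differ by the order of \<open>a\<close> at \<open>z\<close>. If \<open>g z = 0\<close>, then both
  half-orbits \<open>z + \<nat>\<close> and \<open>z - 1 - \<nat>\<close> must meet the support of \<open>a\<close>, otherwise \<open>g\<close> would vanish along a
  progression. The first encounter bounds \<open>Re z\<close> from above and \<open>|Im z|\<close>, the second bounds \<open>Re z\<close> from below.
\<close>
lemma finite_zeros_of_solution:
  assumes g: "mero_nz g" "g \<in> mero_less_1" and a: "mero_nz a" "finite {z. a z = 0}"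
    and eq: "shift g = a \<otimes>\<^bsub>mero\<^esub> g"
  shows "finite {z. g z = 0}"
proof -
  have ord: "zorder g (z + 1) = zorder a z + zorder g z" for z
    using mero_nz_mult(2)[OF a(1) g(1), of z] zorder_shift_1[of g z] eq by (simp add: mero_simps)
  obtain K where K: "\<And>w. a w = 0 \<Longrightarrow> cmod w \<le> K"
    using finite_imp_bounded[OF a(2)] unfolding bounded_iff by auto
  have a0: "zorder a w = 0 \<longleftrightarrow> a w \<noteq> 0" and g0: "zorder g w = 0 \<longleftrightarrow> g w \<noteq> 0" for w
    using mero_nz_zorder_eq_0_iff a(1) g(1) by auto
  have "z \<in> cball 0 (2 * K)" if z: "g z = 0" for z
  proof -
    obtain n :: nat where n: "a (z + of_nat n) = 0"
    proof (rule ccontr)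
      assume "\<not> thesis"
      then have na: "a (z + of_nat n) \<noteq> 0" for n :: nat using that by blast
      have "g (z + of_nat n) = 0" for n :: nat
      proof (induction n)
        case (Suc n)
        have "zorder g (z + of_nat n + 1) = zorder g (z + of_nat n)" using ord[of "z + of_nat n"] na[of n] a0 by simp
        with Suc g0 show ?case by (metis add.assoc add.commute of_nat_Suc)
      qed (simp add: z)
      then show False using mero_less_1_no_zero_progression[OF g, of 1 z] by simp
    qed
    obtain m :: nat where m: "a (z - of_nat m - 1) = 0"
    proof (rule ccontr)
      assume "\<not> thesis"
      then have na: "a (z - of_nat m - 1) \<noteq> 0" for m :: nat using that by blast
      have "g (z - of_nat m) = 0" for m :: nat
      proof (induction m)
        case (Suc m)
        have "zorder g (z - of_nat m - 1) = zorder g (z - of_nat m)" using ord[of "z - of_nat m - 1"] na[of m] a0 by simp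
        with Suc g0 show ?case by (metis diff_diff_eq add.commute of_nat_Suc)
      qed (simp add: z)
      then show False using mero_less_1_no_zero_progression[OF g, of "-1" z] by simp
    qed
    have "\<bar>Re (z + of_nat n)\<bar> \<le> K" "\<bar>Im (z + of_nat n)\<bar> \<le> K" "\<bar>Re (z - of_nat m - 1)\<bar> \<le> K"
      using K[OF n] K[OF m] abs_Re_le_cmod abs_Im_le_cmod order.trans by blast+
    then have "\<bar>Re z\<bar> \<le> K" "\<bar>Im z\<bar> \<le> K" by auto
    then show ?thesis using cmod_le[of z] by simp
  qed
  then have "{z. g z = 0} \<subseteq> {z \<in> cball 0 (2 * K). g z = 0}" by blast
  then show ?thesis using mero_nz_finite_zeros[OF g(1)] finite_subset by blast
qed

text \<open>
  Write \<open>g\<close> as \<open>exp L\<close> times the product over its divisor with \<open>L\<close> entire. The mean of \<open>|Re L|\<close> over the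
  circle of radius \<open>R\<close> is \<open>o(R)\<close> up to the additive constant of the scaling, so the Schwarz bound
  \<open>|L z - L 0| \<le> 2 |z| / (R - |z|) * o(R)\<close> forces \<open>L z = L 0\<close>.
\<close>
lemma mero_less_1_finite_divisor_is_rational:
  assumes g: "mero_nz g" "g \<in> mero_less_1" and fin: "finite {z. g z = 0}"
  obtains C where "C \<noteq> 0" "\<And>z. g z \<noteq> 0 \<Longrightarrow> g z = C * (\<Prod>a\<in>{z. g z = 0}. (z - a) powi zorder g a)"
proof -
  define A where "A = {z. g z = 0}"
  have A: "A = {z \<in> UNIV. g z = 0}" "finite A" using fin by (auto simp: A_def)
  obtain h where h: "h analytic_on UNIV" "\<And>z. z \<in> UNIV \<Longrightarrow> h z \<noteq> 0"
    "\<And>z. z \<in> UNIV - A \<Longrightarrow> g z = h z * (\<Prod>a\<in>A. (z - a) powi zorder g a)"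
    using mero_factorization[OF g(1) A(2,1)] by blast
  obtain L where L: "L holomorphic_on UNIV" "\<And>z. h z = exp (L z)"
    using holomorphic_log_exists[OF analytic_imp_holomorphic[OF h(1)]] h(2) by auto
  define S where "S = (\<Sum>a\<in>A. \<bar>real_of_int (zorder g a)\<bar>)"
  define \<phi> where "\<phi> = (\<lambda>R. nev_proximity R g + nev_proximity R (\<lambda>z. inverse (g z)) + 2 * ln 2 * S)"
  have "(\<lambda>R. nev_proximity R g) \<in> o(\<lambda>r. r)" "(\<lambda>R. nev_proximity R (\<lambda>z. inverse (g z))) \<in> o(\<lambda>r. r)"
    using g mero_nz_inverse[OF g(1)] mero_less_1_inverse[OF g] by (simp_all add: mero_less_1_iff)
  then have \<phi>: "\<phi> \<in> o(\<lambda>r. r)" unfolding \<phi>_def by (intro sum_in_smallo const_smallo_id)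
  obtain K where K: "\<And>w. w \<in> A \<Longrightarrow> cmod w \<le> K"
    using finite_imp_bounded[OF A(2)] unfolding bounded_iff by auto
  have bound: "cmod (L z - L 0) \<le> 2 * cmod z / (R - cmod z) * \<phi> R" if R: "R > cmod z" "R > K" for z R
  proof -
    have R0: "R > 0" using R(1) norm_ge_zero[of z] by linarith
    define L' where "L' = (\<lambda>z. L z + of_real ((\<Sum>a\<in>A. of_int (zorder g a)) * ln R))"
    have L': "L' holomorphic_on UNIV" unfolding L'_def by (intro holomorphic_intros L)
    have "circle_mean 0 R (\<lambda>z. \<bar>Re (L' z)\<bar>) \<le> \<phi> R"
      unfolding \<phi>_def S_def
    proof (rule mean_abs_Re_log_le[OF g(1) R0 A(2) _ L' open_UNIV subset_UNIV])
      show "A \<subseteq> cball 0 R" using K R by force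
      fix w assume w: "w \<in> cball 0 R - A"
      show "ln (cmod (g w)) = Re (L' w) + (\<Sum>a\<in>A. of_int (zorder g a) * ln (cmod (w - a) / R))"
        using h(3)[of w] L(2)[of w] ln_norm_exp_powi_prod[OF R0 A(2), of w "L w" "zorder g"] w
        by (simp add: L'_def)
    qed
    then have "2 * cmod z / (R - cmod z) * circle_mean 0 R (\<lambda>z. \<bar>Re (L' z)\<bar>) \<le> 2 * cmod z / (R - cmod z) * \<phi> R"
      using R by (intro mult_left_mono) auto
    moreover have "cmod (L' z - L' 0) \<le> 2 * cmod z / (R - cmod z) * circle_mean 0 R (\<lambda>z. \<bar>Re (L' z)\<bar>)"
      by (rule Schwarz_integral_bound[OF L' open_UNIV subset_UNIV R(1)])
    ultimately show ?thesis by (simp add: L'_def)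
  qed
  have const: "L z = L 0" for z
  proof -
    have "cmod (L z - L 0) \<le> \<epsilon>" if \<epsilon>: "\<epsilon> > 0" for \<epsilon>
    proof -
      \<comment> \<open>Chosen so that \<open>4 |z| c \<le> \<epsilon>\<close>; the summand 1 covers \<open>z = 0\<close>.\<close>
      define c where "c = \<epsilon> / (4 * (cmod z + 1))"
      have c: "c > 0" using \<epsilon> by (simp add: c_def add_nonneg_pos)
      have "eventually (\<lambda>R. norm (\<phi> R) \<le> c * norm R \<and> R > 2 * cmod z \<and> R > K \<and> R > 0) at_top"
        using landau_o.smallD[OF \<phi> c] by (intro eventually_conj eventually_gt_at_top)
      then obtain R where R: "norm (\<phi> R) \<le> c * norm R" "R > 2 * cmod z" "R > K" "R > 0"
        using eventually_happens[of _ "at_top :: real filter"] by fastforce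
      have z0: "cmod z \<ge> 0" by simp
      have Rz: "R - cmod z \<ge> R / 2" "R > cmod z" using R(2) z0 by linarith+
      have "cmod (L z - L 0) \<le> 2 * cmod z / (R - cmod z) * \<phi> R" by (rule bound[OF Rz(2) R(3)])
      also have "\<dots> \<le> 2 * cmod z / (R - cmod z) * (c * R)"
        using R Rz by (intro mult_left_mono) auto
      also have "\<dots> \<le> 2 * cmod z / (R / 2) * (c * R)"
        using R Rz c by (intro mult_right_mono divide_left_mono) auto
      also have "\<dots> = 4 * cmod z * c" using R by simp
      also have "\<dots> \<le> 4 * (cmod z + 1) * c" using c by (intro mult_right_mono) auto
      also have "\<dots> = \<epsilon>" using z0 by (simp add: c_def add_nonneg_pos less_imp_neq[symmetric])
      finally show ?thesis .
    qed
    then have "cmod (L z - L 0) \<le> 0" using field_le_epsilon[of "cmod (L z - L 0)" 0] by simp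
    then show ?thesis by simp
  qed
  show ?thesis
  proof (rule that[of "exp (L 0)"])
    fix z assume "g z \<noteq> 0"
    then show "g z = exp (L 0) * (\<Prod>a\<in>{z. g z = 0}. (z - a) powi zorder g a)"
      using h(3)[of z] L(2)[of z] const[of z] by (simp add: A_def)
  qed simp
qed

section \<open>Membership in $\mathbf{k}(z)$\<close>

lemma adjoin_z_subset: "insert (\<lambda>z. z) periodic_mero \<subseteq> carrier mero"
  using mero_less_1_carrier[OF ident_mem_mero_less_1] by (auto simp: periodic_mero_def)

lemma adjoin_z_carrier: "f \<in> adjoin_z periodic_mero \<Longrightarrow> f \<in> carrier mero"
  unfolding adjoin_z_def by (rule field.generate_field_in_carrier[OF field_mero adjoin_z_subset])

lemma periodic_in_adjoin_z: "f \<in> periodic_mero \<Longrightarrow> f \<in> adjoin_z periodic_mero"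
  unfolding adjoin_z_def by (rule generate_field.incl) simp

lemma const_in_adjoin_z: "(\<lambda>_. c) \<in> adjoin_z periodic_mero"
  by (rule periodic_in_adjoin_z) (auto simp: periodic_mero_def mero_simps shift_def)

lemma adjoin_z_mult:
  "f \<in> adjoin_z periodic_mero \<Longrightarrow> g \<in> adjoin_z periodic_mero \<Longrightarrow> f \<otimes>\<^bsub>mero\<^esub> g \<in> adjoin_z periodic_mero"
  unfolding adjoin_z_def by (rule generate_field.eng_mult)

lemma power_in_adjoin_z: "(\<lambda>z. (z - a) ^ n) \<in> adjoin_z periodic_mero"
proof (induction n)
  case 0
  then show ?case using const_in_adjoin_z[of 1] by simp
next
  case (Suc n)
  have z: "(\<lambda>z. z) \<in> adjoin_z periodic_mero" unfolding adjoin_z_def by (rule generate_field.incl) simp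
  have "(\<lambda>z. z) \<oplus>\<^bsub>mero\<^esub> (\<lambda>_. - a) \<in> adjoin_z periodic_mero"
    using z const_in_adjoin_z[of "- a"] unfolding adjoin_z_def by (rule generate_field.eng_add)
  also have "(\<lambda>z. z) \<oplus>\<^bsub>mero\<^esub> (\<lambda>_. - a) = (\<lambda>z. z - a)"
    by (simp add: mero_simps) (intro entire_remove_sings analytic_intros)
  finally have "(\<lambda>z. z - a) \<otimes>\<^bsub>mero\<^esub> (\<lambda>z. (z - a) ^ n) \<in> adjoin_z periodic_mero"
    using Suc.IH by (rule adjoin_z_mult)
  also have "(\<lambda>z. z - a) \<otimes>\<^bsub>mero\<^esub> (\<lambda>z. (z - a) ^ n) = (\<lambda>z. (z - a) ^ Suc n)"
    by (simp add: mero_simps) (intro entire_remove_sings analytic_intros)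
  finally show ?case .
qed

lemma powi_in_adjoin_z: "(\<lambda>z. (z - a) powi n) \<in> adjoin_z periodic_mero"
proof (cases "n \<ge> 0")
  case True
  then show ?thesis using power_in_adjoin_z[of a "nat n"] by (simp add: power_int_def)
next
  case False
  let ?f = "\<lambda>z. (z - a) ^ nat (- n)"
  have "?f (a + 1) \<noteq> 0" by simp
  then have "?f \<noteq> \<zero>\<^bsub>mero\<^esub>" unfolding mero_simps by metis
  moreover have "?f \<in> adjoin_z periodic_mero" by (rule power_in_adjoin_z)
  ultimately have "inv\<^bsub>mero\<^esub> ?f \<in> adjoin_z periodic_mero" "inv\<^bsub>mero\<^esub> ?f = (\<lambda>z. inverse (?f z))"
    using mero_inv[OF adjoin_z_carrier] generate_field.m_inv[of ?f mero] unfolding adjoin_z_def by blast+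
  then show ?thesis using False by (simp add: power_int_def power_inverse)
qed

lemma prod_powi_in_adjoin_z:
  assumes "finite A"
  shows "remove_sings (\<lambda>z. \<Prod>a\<in>A. (z - a) powi e a) \<in> adjoin_z periodic_mero"
  using assms
proof (induction A rule: finite_induct)
  case empty
  then show ?case using const_in_adjoin_z[of 1] by (simp add: remove_sings_const)
next
  case (insert a A)
  have m: "(\<lambda>z. \<Prod>a\<in>A. (z - a) powi e a) meromorphic_on UNIV" by (intro meromorphic_intros)
  from adjoin_z_mult[OF powi_in_adjoin_z[of a "e a"] insert.IH] insert.hyps
  show ?case by (simp add: mero_simps remove_sings_mult_right[OF m])
qed

section \<open>The periodic quotient of two solutions\<close>

text \<open>
  Part (1) is the specialization argument, and the solution \<open>b'\<close> found there is rational. The quotient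
  \<open>p = b / b'\<close> satisfies \<open>shift p * (a b') = p * (a b')\<close>, so it is periodic, and \<open>b = p b'\<close>.
\<close>
theorem lemma3p2:
  fixes a b :: "complex \<Rightarrow> complex"
  assumes "a \<in> rational_mero - {\<zero>\<^bsub>mero\<^esub>}"
    and "b \<in> compositum periodic_mero mero_less_1"
    and "b \<noteq> \<zero>\<^bsub>mero\<^esub>"
    and "shift b = a \<otimes>\<^bsub>mero\<^esub> b"
  shows "(\<exists>b'\<in>mero_less_1. b' \<noteq> \<zero>\<^bsub>mero\<^esub> \<and> shift b' = a \<otimes>\<^bsub>mero\<^esub> b')
    \<and> b \<in> adjoin_z periodic_mero"
proof -
  have a: "a \<in> rational_mero" "a \<noteq> \<zero>\<^bsub>mero\<^esub>" using assms(1) by auto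
  have ac: "a \<in> carrier mero" using mero_less_1_carrier[OF rational_mem_mero_less_1[OF a(1)]] .
  obtain b' where b': "b' \<in> mero_less_1" "b' \<noteq> \<zero>\<^bsub>mero\<^esub>" "shift b' = a \<otimes>\<^bsub>mero\<^esub> b'"
    using exists_solution_less_1[OF a(1) assms(2-4)] by blast
  have b'c: "b' \<in> carrier mero" by (rule mero_less_1_carrier[OF b'(1)])
  have nz: "mero_nz a" "mero_nz b'" using a(2) b'(2) ac b'c mero_carrier_iff_nz by auto
  have bc: "b \<in> carrier mero"
    by (rule field.generate_field_in_carrier[OF field_mero _ assms(2)[unfolded compositum_def]])
       (auto simp: periodic_mero_def mero_less_1_def)
  have fin: "finite {z. b' z = 0}"
    using finite_zeros_of_solution[OF nz(2) b'(1) nz(1) finite_rational_zeros[OF a(1)]] a(2) b'(3)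
    by (simp add: mero_simps)
  obtain C where C: "\<And>z. b' z \<noteq> 0 \<Longrightarrow> b' z = C * (\<Prod>a\<in>{z. b' z = 0}. (z - a) powi zorder b' a)"
    using mero_less_1_finite_divisor_is_rational[OF nz(2) b'(1) fin] by blast
  have b'_rat: "b' \<in> adjoin_z periodic_mero"
  proof -
    let ?P = "\<lambda>z. \<Prod>a\<in>{z. b' z = 0}. (z - a) powi zorder b' a"
    have m: "?P meromorphic_on UNIV" by (intro meromorphic_intros)
    have "b' = remove_sings b'" using b'c by (simp add: nicely_mero_remove_sings mero_simps)
    also have "\<dots> = remove_sings (\<lambda>z. C * ?P z)"
      by (rule remove_sings_eqI_at) (rule eventually_mono[OF mero_nz_eventually[OF nz(2)] C])
    also have "\<dots> = (\<lambda>_. C) \<otimes>\<^bsub>mero\<^esub> remove_sings ?P"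
      by (simp add: mero_simps remove_sings_mult_right[OF m])
    also have "\<dots> \<in> adjoin_z periodic_mero"
      by (intro adjoin_z_mult const_in_adjoin_z prod_powi_in_adjoin_z fin)
    finally show ?thesis .
  qed
  define p where "p = b \<otimes>\<^bsub>mero\<^esub> inv\<^bsub>mero\<^esub> b'"
  have unit: "b' \<in> Units mero" using field.field_Units[OF field_mero] b'c b'(2) by simp
  have pc: "p \<in> carrier mero" unfolding p_def using bc unit by simp
  have b_eq: "b = p \<otimes>\<^bsub>mero\<^esub> b'" unfolding p_def using bc unit b'c by (simp add: M.m_assoc)
  have spc: "shift p \<in> carrier mero" using pc nicely_meromorphic_shift by (simp add: mero_simps)
  have "shift p \<otimes>\<^bsub>mero\<^esub> (a \<otimes>\<^bsub>mero\<^esub> b') = p \<otimes>\<^bsub>mero\<^esub> (a \<otimes>\<^bsub>mero\<^esub> b')"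
  proof -
    have "shift p \<otimes>\<^bsub>mero\<^esub> (a \<otimes>\<^bsub>mero\<^esub> b') = shift b" using b_eq shift_mult[of p b'] b'(3) by simp
    also have "\<dots> = a \<otimes>\<^bsub>mero\<^esub> (p \<otimes>\<^bsub>mero\<^esub> b')" using assms(4) b_eq by simp
    also have "\<dots> = p \<otimes>\<^bsub>mero\<^esub> (a \<otimes>\<^bsub>mero\<^esub> b')" using ac pc b'c by (rule M.m_lcomm)
    finally show ?thesis .
  qed
  moreover have "a \<otimes>\<^bsub>mero\<^esub> b' \<noteq> \<zero>\<^bsub>mero\<^esub>" using M.integral_iff[OF ac b'c] a(2) b'(2) by simp
  ultimately have "shift p = p" using M.m_rcancel[of "a \<otimes>\<^bsub>mero\<^esub> b'" "shift p" p] ac b'c pc spc by simp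
  then have "p \<in> periodic_mero" using pc by (simp add: periodic_mero_def)
  then have "b \<in> adjoin_z periodic_mero"
    unfolding b_eq by (intro adjoin_z_mult periodic_in_adjoin_z b'_rat)
  with b' show ?thesis by blast
qed

end
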